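(* For an integer $d\ge1$, for $\sigma\in S_4$, and for $a\in\mathbb F\setminus\{0,1\}$, the following $\boxtimes$-modules are isomorphic: (i) the $\boxtimes$-module $V_d(a)$ twisted via $\sigma$; (ii) the $\boxtimes$-module $V_d(\sigma(a))$.
   Context: $\mathbb F$ is an algebraically closed field of characteristic $0$, and $\mathbb I=\{0,1,2,3\}$. The tetrahedron algebra $\boxtimes$ is the Lie algebra over $\mathbb F$ with generators $\{x_{ij}\mid i,j\in\mathbb I,\ i\ne j\}$ and relations: (i) $x_{ij}+x_{ji}=0$ for distinct $i,j$; (ii) $[x_{ij},x_{jk}]=2x_{ij}+2x_{jk}$ for mutually distinct $i,j,k$; (iii) $[x_{ij},[x_{ij},[x_{ij},x_{k\ell}]]]=4[x_{ij},x_{k\ell}]$ for mutually distinct $i,j,k,\ell$. Evaluation modules: let $\mathfrak{sl}_2=\mathfrak{sl}_2(\mathbb F)$ with basis $e,f,h$, $[h,e]=2e$, $[h,f]=-2f$, $[e,f]=h$. Put $x=2e-h$, $y=-2f-h$, $z=h$. For $a\in\mathbb F\setminus\{0,1\}$ let $EV_a:\boxtimes\to\mathfrak{sl}_2$ be the (surjective) Lie algebra homomorphism with $x_{12}\mapsto x$, $x_{23}\mapsto y$, $x_{31}\mapsto z$, $x_{03}\mapsto ay+(a-1)z$, $x_{01}\mapsto(1-a^{-1})z-a^{-1}x$, $x_{02}\mapsto(1-a)^{-1}x+a(1-a)^{-1}y$. For $d\ge0$ let $V_d$ be the irreducible $\mathfrak{sl}_2$-module of dimension $d+1$. For $d\ge1$,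 $V_d(a)$ is the $\boxtimes$-module obtained from $V_d$ by pulling back the action via $EV_a$. $S_4$ is the group of permutations of $\mathbb I$ (left actions; products composed right to left). It acts on $\boxtimes$ by Lie algebra automorphisms with $\sigma(x_{ij})=x_{\sigma(i),\sigma(j)}$. For a $\boxtimes$-module $V$ and $\sigma\in S_4$, "$V$ twisted via $\sigma$" (written ${}^\sigma V$) is the $\boxtimes$-module on the same vector space in which $\xi\in\boxtimes$ acts as $\sigma^{-1}(\xi)$ acts on the original $V$. $S_4$ also acts on the set $\mathbb F\setminus\{0,1\}$: this is the unique action such that for all $a\in\mathbb F\setminus\{0,1\}$ the transposition $(2,0)$ sends $a\mapsto a^{-1}$, the transposition $(0,1)$ sends $a\mapsto a(a-1)^{-1}$, and the transposition $(1,3)$ sends $a\mapsto a^{-1}$. The notation $\sigma(a)$ refers to this action. *)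

theory Defs
  imports "HOL-Analysis.Analysis" "HOL-Computational_Algebra.Polynomial"
begin

section \<open>Lie algebras and their modules\<close>

locale lie_algebra = vector_space scale
  for scale :: "'a::field \<Rightarrow> 'l::ab_group_add \<Rightarrow> 'l" +
  fixes bracket :: "'l \<Rightarrow> 'l \<Rightarrow> 'l"
  assumes bracket_add_left: "bracket (x + y) z = bracket x z + bracket y z"
    and bracket_add_right: "bracket x (y + z) = bracket x y + bracket x z"
    and bracket_scale_left: "bracket (scale c x) y = scale c (bracket x y)"
    and bracket_scale_right: "bracket x (scale c y) = scale c (bracket x y)"
    and bracket_self: "bracket x x = 0"
    and jacobi: "bracket x (bracket y z) + bracket y (bracket z x) + bracket z (bracket x y) = 0"

locale lie_hom = Vector_Spaces.linear s1 s2 \<phi> + L1: lie_algebra s1 br1 + L2: lie_algebra s2 br2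
  for s1 :: "'a::field \<Rightarrow> 'l::ab_group_add \<Rightarrow> 'l" and br1 :: "'l \<Rightarrow> 'l \<Rightarrow> 'l"
    and s2 :: "'a \<Rightarrow> 'm::ab_group_add \<Rightarrow> 'm" and br2 :: "'m \<Rightarrow> 'm \<Rightarrow> 'm"
    and \<phi> :: "'l \<Rightarrow> 'm" +
  assumes hom_bracket: "\<phi> (br1 x y) = br2 (\<phi> x) (\<phi> y)"

text \<open>The underlying vector space of a module is a whole type, with scalar multiplication \<open>s\<close>;
  \<open>act \<xi> v\<close> is the action of \<open>\<xi>\<close> on \<open>v\<close>.\<close>

locale lie_module = L: lie_algebra sL br + V: vector_space s
  for sL :: "'a::field \<Rightarrow> 'l::ab_group_add \<Rightarrow> 'l" and br :: "'l \<Rightarrow> 'l \<Rightarrow> 'l"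
    and s :: "'a \<Rightarrow> 'v::ab_group_add \<Rightarrow> 'v" +
  fixes act :: "'l \<Rightarrow> 'v \<Rightarrow> 'v"
  assumes act_add_left: "act (x + y) v = act x v + act y v"
    and act_scale_left: "act (sL c x) v = s c (act x v)"
    and act_add_right: "act x (v + w) = act x v + act x w"
    and act_scale_right: "act x (s c v) = s c (act x v)"
    and act_bracket: "act (br x y) v = act x (act y v) - act y (act x v)"

definition lie_module_irreducible ::
  "('a::field \<Rightarrow> 'l::ab_group_add \<Rightarrow> 'l) \<Rightarrow> ('l \<Rightarrow> 'l \<Rightarrow> 'l) \<Rightarrow>
   ('a \<Rightarrow> 'v::ab_group_add \<Rightarrow> 'v) \<Rightarrow> ('l \<Rightarrow> 'v \<Rightarrow> 'v) \<Rightarrow> bool" where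
  "lie_module_irreducible sL br s act \<longleftrightarrow>
     lie_module sL br s act \<and> (\<exists>v::'v. v \<noteq> 0) \<and>
     (\<forall>W. module.subspace s W \<and> (\<forall>\<xi>. \<forall>w\<in>W. act \<xi> w \<in> W) \<longrightarrow> W = {0} \<or> W = UNIV)"

definition lie_module_iso ::
  "('a::field \<Rightarrow> 'l::ab_group_add \<Rightarrow> 'l) \<Rightarrow> ('l \<Rightarrow> 'l \<Rightarrow> 'l) \<Rightarrow>
   ('a \<Rightarrow> 'v::ab_group_add \<Rightarrow> 'v) \<Rightarrow> ('l \<Rightarrow> 'v \<Rightarrow> 'v) \<Rightarrow>
   ('a \<Rightarrow> 'w::ab_group_add \<Rightarrow> 'w) \<Rightarrow> ('l \<Rightarrow> 'w \<Rightarrow> 'w) \<Rightarrow> bool" where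
  "lie_module_iso sL br s act s' act' \<longleftrightarrow>
     lie_module sL br s act \<and> lie_module sL br s' act' \<and>
     (\<exists>\<gamma>. Vector_Spaces.linear s s' \<gamma> \<and> bij \<gamma> \<and> (\<forall>\<xi> v. \<gamma> (act \<xi> v) = act' \<xi> (\<gamma> v)))"


section \<open>Lie algebras given by generators and relations\<close>

datatype ('a, 'g) lie_term =
    Gen 'g
  | Zero
  | Add "('a, 'g) lie_term" "('a, 'g) lie_term"
  | Scale 'a "('a, 'g) lie_term"
  | Brk "('a, 'g) lie_term" "('a, 'g) lie_term"

text \<open>The least congruence that contains the pairs in \<open>R\<close> and modulo which the terms form a
  Lie algebra. The negative of \<open>t\<close> is \<open>Scale (-1) t\<close>.\<close>

inductive lie_cong ::
  "(('a::field, 'g) lie_term \<times> ('a, 'g) lie_term) set \<Rightarrow>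
   ('a, 'g) lie_term \<Rightarrow> ('a, 'g) lie_term \<Rightarrow> bool"
  for R where
  rel: "(t, u) \<in> R \<Longrightarrow> lie_cong R t u"
| refl: "lie_cong R t t"
| sym: "lie_cong R t u \<Longrightarrow> lie_cong R u t"
| trans: "lie_cong R t u \<Longrightarrow> lie_cong R u v \<Longrightarrow> lie_cong R t v"
| cong_Add: "lie_cong R t t' \<Longrightarrow> lie_cong R u u' \<Longrightarrow> lie_cong R (Add t u) (Add t' u')"
| cong_Scale: "lie_cong R t t' \<Longrightarrow> lie_cong R (Scale c t) (Scale c t')"
| cong_Brk: "lie_cong R t t' \<Longrightarrow> lie_cong R u u' \<Longrightarrow> lie_cong R (Brk t u) (Brk t' u')"
| add_assoc: "lie_cong R (Add (Add t u) v) (Add t (Add u v))"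
| add_comm: "lie_cong R (Add t u) (Add u t)"
| add_zero: "lie_cong R (Add Zero t) t"
| add_neg: "lie_cong R (Add (Scale (-1) t) t) Zero"
| scale_add_right: "lie_cong R (Scale c (Add t u)) (Add (Scale c t) (Scale c u))"
| scale_add_left: "lie_cong R (Scale (c + d) t) (Add (Scale c t) (Scale d t))"
| scale_scale: "lie_cong R (Scale c (Scale d t)) (Scale (c * d) t)"
| scale_one: "lie_cong R (Scale 1 t) t"
| brk_add_left: "lie_cong R (Brk (Add t u) v) (Add (Brk t v) (Brk u v))"
| brk_add_right: "lie_cong R (Brk t (Add u v)) (Add (Brk t u) (Brk t v))"
| brk_scale_left: "lie_cong R (Brk (Scale c t) u) (Scale c (Brk t u))"
| brk_scale_right: "lie_cong R (Brk t (Scale c u)) (Scale c (Brk t u))"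
| brk_self: "lie_cong R (Brk t t) Zero"
| brk_jacobi: "lie_cong R (Add (Add (Brk t (Brk u v)) (Brk u (Brk v t))) (Brk v (Brk t u))) Zero"

lemma equivp_lie_cong: "equivp (lie_cong R)"
  by (intro equivpI reflpI sympI transpI) (fact lie_cong.refl lie_cong.sym lie_cong.trans)+

primrec lie_eval ::
  "('a \<Rightarrow> 'l::ab_group_add \<Rightarrow> 'l) \<Rightarrow> ('l \<Rightarrow> 'l \<Rightarrow> 'l) \<Rightarrow> ('g \<Rightarrow> 'l) \<Rightarrow> ('a, 'g) lie_term \<Rightarrow> 'l" where
  "lie_eval s br g (Gen x) = g x"
| "lie_eval s br g Zero = 0"
| "lie_eval s br g (Add t u) = lie_eval s br g t + lie_eval s br g u"
| "lie_eval s br g (Scale c t) = s c (lie_eval s br g t)"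
| "lie_eval s br g (Brk t u) = br (lie_eval s br g t) (lie_eval s br g u)"

lemma lie_eval_cong:
  assumes "lie_algebra s br"
    and R: "\<And>t u. (t, u) \<in> R \<Longrightarrow> lie_eval s br g t = lie_eval s br g u"
    and "lie_cong R t u"
  shows "lie_eval s br g t = lie_eval s br g u"
proof -
  interpret lie_algebra s br by fact
  show ?thesis using assms(3)
    by induction
      (simp_all add: R bracket_add_left bracket_add_right bracket_scale_left bracket_scale_right
         bracket_self jacobi[unfolded add.assoc] scale_right_distrib scale_left_distrib ac_simps)
qed


section \<open>The tetrahedron algebra\<close>

text \<open>The index set \<open>{0,1,2,3}\<close> is the type \<open>4\<close>; there, \<open>4 = 0\<close>. The generators are
  indexed by the ordered pairs of distinct indices.\<close>

lemma index_cases: "(i::4) = 0 \<or> i = 1 \<or> i = 2 \<or> i = 3"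
  using exhaust_4[of i] by auto

typedef arc = "{(i, j). (i::4) \<noteq> j}"
  by (rule exI[of _ "(0, 1)"]) simp

abbreviation (input) X :: "4 \<Rightarrow> 4 \<Rightarrow> ('a, arc) lie_term" where
  "X i j \<equiv> Gen (Abs_arc (i, j))"

inductive_set tet_rel :: "(('a::field, arc) lie_term \<times> ('a, arc) lie_term) set" where
  "i \<noteq> j \<Longrightarrow> (Add (X i j) (X j i), Zero) \<in> tet_rel"
| "distinct [i, j, k] \<Longrightarrow>
     (Brk (X i j) (X j k), Add (Scale 2 (X i j)) (Scale 2 (X j k))) \<in> tet_rel"
| "distinct [i, j, k, l] \<Longrightarrow>
     (Brk (X i j) (Brk (X i j) (Brk (X i j) (X k l))), Scale 4 (Brk (X i j) (X k l))) \<in> tet_rel"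

quotient_type (overloaded) 'a tet = "('a::field, arc) lie_term" / "lie_cong tet_rel"
  by (rule equivp_lie_cong)

instantiation tet :: (field) ab_group_add
begin

lift_definition zero_tet :: "'a tet" is Zero .
lift_definition plus_tet :: "'a tet \<Rightarrow> 'a tet \<Rightarrow> 'a tet" is Add by (rule cong_Add)
lift_definition uminus_tet :: "'a tet \<Rightarrow> 'a tet" is "Scale (-1)" by (rule cong_Scale)
definition minus_tet :: "'a tet \<Rightarrow> 'a tet \<Rightarrow> 'a tet" where "minus_tet x y = x + (- y)"

instance
proof
  fix a b c :: "'a tet"
  show "a + b + c = a + (b + c)" "a + b = b + a" "0 + a = a" "- a + a = 0"
    by (transfer, rule lie_cong.add_assoc lie_cong.add_comm lie_cong.add_zero lie_cong.add_neg)+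
  show "a - b = a + - b" by (simp add: minus_tet_def)
qed

end

lift_definition tet_scale :: "'a::field \<Rightarrow> 'a tet \<Rightarrow> 'a tet" is Scale by (rule cong_Scale)
lift_definition tet_bracket :: "'a::field tet \<Rightarrow> 'a tet \<Rightarrow> 'a tet" is Brk by (rule cong_Brk)

text \<open>\<open>tet_x i j\<close> is the generator $x_{ij}$; it is unspecified for \<open>i = j\<close>.\<close>

lift_definition tet_x :: "4 \<Rightarrow> 4 \<Rightarrow> 'a::field tet" is "\<lambda>i j. Gen (Abs_arc (i, j))" .

lemma lie_algebra_tet: "lie_algebra tet_scale (tet_bracket :: 'a::field tet \<Rightarrow> _)"
  by unfold_locales
    (transfer, rule lie_cong.scale_add_right lie_cong.scale_add_left lie_cong.scale_scale
       lie_cong.scale_one lie_cong.brk_add_left lie_cong.brk_add_right lie_cong.brk_scale_left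
       lie_cong.brk_scale_right lie_cong.brk_self lie_cong.brk_jacobi)+

lemma tet_relations:
  fixes i j k l :: 4
  shows "i \<noteq> j \<Longrightarrow> tet_x i j + tet_x j i = (0 :: 'a::field tet)"
    and "distinct [i, j, k] \<Longrightarrow>
      tet_bracket (tet_x i j) (tet_x j k) = tet_scale 2 (tet_x i j) + tet_scale 2 (tet_x j k :: 'a tet)"
    and "distinct [i, j, k, l] \<Longrightarrow>
      tet_bracket (tet_x i j) (tet_bracket (tet_x i j) (tet_bracket (tet_x i j) (tet_x k l))) =
      tet_scale 4 (tet_bracket (tet_x i j) (tet_x k l :: 'a tet))"
  by (transfer, rule lie_cong.rel, erule tet_rel.intros)+

theorem tet_universal:
  fixes s :: "'a::field \<Rightarrow> 'l::ab_group_add \<Rightarrow> 'l" and g :: "4 \<Rightarrow> 4 \<Rightarrow> 'l"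
  assumes L: "lie_algebra s br"
    and g1: "\<And>i j. i \<noteq> j \<Longrightarrow> g i j + g j i = 0"
    and g2: "\<And>i j k. distinct [i, j, k] \<Longrightarrow> br (g i j) (g j k) = s 2 (g i j) + s 2 (g j k)"
    and g3: "\<And>i j k l. distinct [i, j, k, l] \<Longrightarrow>
      br (g i j) (br (g i j) (br (g i j) (g k l))) = s 4 (br (g i j) (g k l))"
  shows "\<exists>!\<phi>. lie_hom tet_scale tet_bracket s br \<phi> \<and> (\<forall>i j. i \<noteq> j \<longrightarrow> \<phi> (tet_x i j) = g i j)"
proof -
  interpret T: lie_algebra tet_scale "tet_bracket :: 'a tet \<Rightarrow> _" by (rule lie_algebra_tet)
  interpret L: lie_algebra s br by fact
  define ev where "ev = lie_eval s br (\<lambda>a. case Rep_arc a of (i, j) \<Rightarrow> g i j)"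
  have ev_X: "ev (X i j) = g i j" if "i \<noteq> j" for i j
    using that by (simp add: ev_def Abs_arc_inverse)
  have ev_simps: "ev Zero = 0" "ev (Add t u) = ev t + ev u" "ev (Scale c t) = s c (ev t)"
    "ev (Brk t u) = br (ev t) (ev u)" for t u c
    by (simp_all add: ev_def)
  have rel: "ev t = ev u" if "(t, u) \<in> tet_rel" for t u
    using that by cases (simp_all add: ev_simps ev_X g1 g2 g3)
  have cong: "ev t = ev u" if "lie_cong tet_rel t u" for t u
    unfolding ev_def by (rule lie_eval_cong[OF L _ that]) (rule rel[unfolded ev_def])
  define \<phi> where "\<phi> y = ev (rep_tet y)" for y
  have \<phi>_abs: "\<phi> (abs_tet t) = ev t" for t
    unfolding \<phi>_def by (rule cong) (rule Quotient3_rep_abs[OF Quotient3_tet lie_cong.refl])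
  have abs_surj: "\<exists>t. y = abs_tet t" for y :: "'a tet"
    using Quotient3_abs_rep[OF Quotient3_tet, of y, symmetric] by (rule exI)
  have hom: "lie_hom tet_scale tet_bracket s br \<phi>"
  proof unfold_locales
    fix y z :: "'a tet" and c
    obtain t u where tu: "y = abs_tet t" "z = abs_tet u"
      using abs_surj by blast
    show "\<phi> (y + z) = \<phi> y + \<phi> z" "\<phi> (tet_scale c y) = s c (\<phi> y)"
      "\<phi> (tet_bracket y z) = br (\<phi> y) (\<phi> z)"
      by (simp_all add: tu plus_tet.abs_eq tet_scale.abs_eq tet_bracket.abs_eq \<phi>_abs ev_simps)
  qed
  have gen: "\<phi> (tet_x i j) = g i j" if "i \<noteq> j" for i j
    using that by (simp add: tet_x.abs_eq \<phi>_abs ev_X)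
  have uniq: "\<psi> = \<phi>" if h: "lie_hom tet_scale tet_bracket s br \<psi>"
    and e: "\<forall>i j. i \<noteq> j \<longrightarrow> \<psi> (tet_x i j) = g i j" for \<psi>
  proof
    interpret h: lie_hom tet_scale tet_bracket s br \<psi> by fact
    have "\<psi> (abs_tet t) = ev t" for t
    proof (induction t)
      case (Gen a)
      obtain i j where "a = Abs_arc (i, j)" "i \<noteq> j" by (cases a) auto
      with e[rule_format, of i j] show ?case by (simp add: ev_X tet_x.abs_eq)
    next
      case Zero
      show ?case by (simp only: zero_tet.abs_eq[symmetric] h.zero ev_simps)
    next
      case (Add t u)
      then show ?case by (simp only: plus_tet.abs_eq[symmetric] h.add ev_simps)
    next
      case (Scale c t)
      then show ?case by (simp only: tet_scale.abs_eq[symmetric] h.scale ev_simps)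
    next
      case (Brk t u)
      then show ?case by (simp only: tet_bracket.abs_eq[symmetric] h.hom_bracket ev_simps)
    qed
    then show "\<psi> y = \<phi> y" for y
      using abs_surj[of y] \<phi>_abs by auto
  qed
  show ?thesis
  proof (rule ex1I[of _ \<phi>], intro conjI allI impI)
    fix \<psi>
    assume "lie_hom tet_scale tet_bracket s br \<psi> \<and> (\<forall>i j. i \<noteq> j \<longrightarrow> \<psi> (tet_x i j) = g i j)"
    then show "\<psi> = \<phi>" by (elim conjE) (rule uniq)
  qed (fact hom, rule gen)
qed

text \<open>The description below determines a unique homomorphism if \<open>\<sigma>\<close> is bijective; see the
  lemma \<open>S4_aut\<close>.\<close>

definition S4_aut :: "(4 \<Rightarrow> 4) \<Rightarrow> 'a::field tet \<Rightarrow> 'a tet" where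
  "S4_aut \<sigma> = (THE \<phi>. lie_hom tet_scale tet_bracket tet_scale tet_bracket \<phi> \<and>
     (\<forall>i j. i \<noteq> j \<longrightarrow> \<phi> (tet_x i j) = tet_x (\<sigma> i) (\<sigma> j)))"

lemma S4_aut:
  assumes "bij \<sigma>"
  shows "lie_hom tet_scale tet_bracket tet_scale tet_bracket (S4_aut \<sigma>)"
    and "i \<noteq> j \<Longrightarrow> S4_aut \<sigma> (tet_x i j) = tet_x (\<sigma> i) (\<sigma> j)"
proof -
  have "\<exists>!\<phi>. lie_hom tet_scale tet_bracket tet_scale tet_bracket \<phi> \<and>
     (\<forall>i j. i \<noteq> j \<longrightarrow> \<phi> (tet_x i j) = tet_x (\<sigma> i) (\<sigma> j))"
    using bij_is_inj[OF assms]
    by (intro tet_universal lie_algebra_tet tet_relations) (auto simp: inj_eq)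
  from theI'[OF this, folded S4_aut_def]
  show "lie_hom tet_scale tet_bracket tet_scale tet_bracket (S4_aut \<sigma>)"
    and "i \<noteq> j \<Longrightarrow> S4_aut \<sigma> (tet_x i j) = tet_x (\<sigma> i) (\<sigma> j)" by auto
qed

definition twist :: "(4 \<Rightarrow> 4) \<Rightarrow> ('a::field tet \<Rightarrow> 'v \<Rightarrow> 'v) \<Rightarrow> 'a tet \<Rightarrow> 'v \<Rightarrow> 'v" where
  "twist \<sigma> act \<xi> = act (S4_aut (inv \<sigma>) \<xi>)"


section \<open>The Lie algebra \<open>sl\<^sub>2\<close> and evaluation modules\<close>

typedef (overloaded) 'a sl2 = "{A :: 'a::field^2^2. trace A = 0}"
  by (rule exI[of _ 0]) (simp add: trace_def)

setup_lifting type_definition_sl2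

instantiation sl2 :: (field) ab_group_add
begin

lift_definition zero_sl2 :: "'a sl2" is 0 by (simp add: trace_def)
lift_definition plus_sl2 :: "'a sl2 \<Rightarrow> 'a sl2 \<Rightarrow> 'a sl2" is "(+)" by (simp add: trace_add)
lift_definition minus_sl2 :: "'a sl2 \<Rightarrow> 'a sl2 \<Rightarrow> 'a sl2" is "(-)" by (simp add: trace_sub)
lift_definition uminus_sl2 :: "'a sl2 \<Rightarrow> 'a sl2" is uminus by (simp add: trace_def sum_negf)

instance
  by standard (transfer, simp)+

end

lift_definition sl2_scale :: "'a::field \<Rightarrow> 'a sl2 \<Rightarrow> 'a sl2" is
  "\<lambda>c A. \<chi> i j. c * A $ i $ j"
  by (simp add: trace_def sum_2 flip: distrib_left)

lift_definition sl2_bracket :: "'a::field sl2 \<Rightarrow> 'a sl2 \<Rightarrow> 'a sl2" is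
  "\<lambda>A B. A ** B - B ** A"
  by (metis right_minus_eq trace_mul_sym trace_sub)

lift_definition sl2_e :: "'a::field sl2" is "vector [vector [0, 1], vector [0, 0]]"
  by (simp add: trace_def sum_2)
lift_definition sl2_f :: "'a::field sl2" is "vector [vector [0, 0], vector [1, 0]]"
  by (simp add: trace_def sum_2)
lift_definition sl2_h :: "'a::field sl2" is "vector [vector [1, 0], vector [0, -1]]"
  by (simp add: trace_def sum_2)

definition sl2_x :: "'a::field sl2" where "sl2_x = sl2_scale 2 sl2_e - sl2_h"
definition sl2_y :: "'a::field sl2" where "sl2_y = sl2_scale (-2) sl2_f - sl2_h"
definition sl2_z :: "'a::field sl2" where "sl2_z = sl2_h"

lemma lie_algebra_sl2: "lie_algebra sl2_scale (sl2_bracket :: 'a::field sl2 \<Rightarrow> _)"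
  by unfold_locales
    (transfer, simp add: vec_eq_iff matrix_matrix_mult_def sum_2 forall_2 algebra_simps)+

lemma sl2_ef_brackets:
  "sl2_bracket sl2_h sl2_e = sl2_scale 2 (sl2_e :: 'a::field sl2)"
  "sl2_bracket sl2_h sl2_f = sl2_scale (-2) (sl2_f :: 'a::field sl2)"
  "sl2_bracket sl2_e sl2_f = (sl2_h :: 'a::field sl2)"
  by (transfer, simp add: vec_eq_iff matrix_matrix_mult_def sum_2 forall_2)+

definition EV :: "'a::field \<Rightarrow> 'a tet \<Rightarrow> 'a sl2" where
  "EV a = (THE \<phi>. lie_hom tet_scale tet_bracket sl2_scale sl2_bracket \<phi> \<and>
     \<phi> (tet_x 1 2) = sl2_x \<and> \<phi> (tet_x 2 3) = sl2_y \<and> \<phi> (tet_x 3 1) = sl2_z \<and>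
     \<phi> (tet_x 0 3) = sl2_scale a sl2_y + sl2_scale (a - 1) sl2_z \<and>
     \<phi> (tet_x 0 1) = sl2_scale (1 - inverse a) sl2_z - sl2_scale (inverse a) sl2_x \<and>
     \<phi> (tet_x 0 2) = sl2_scale (inverse (1 - a)) sl2_x + sl2_scale (a * inverse (1 - a)) sl2_y)"

text \<open>The description in \<open>EV_def\<close> determines a unique homomorphism if \<open>a\<close> is neither 0 nor 1; the
  proof ends with the lemma \<open>EV\<close>. The generator $x_{ij}$ is
  sent to the matrix with eigenvalues -1 at \<open>p i\<close> and 1 at \<open>p j\<close>, for the following four pairwise
  independent vectors \<open>p i = (EV_u i, EV_v a i)\<close>.\<close>

definition EV_u :: "4 \<Rightarrow> 'a::field" where "EV_u i = (if i = 3 then 0 else 1)"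
definition EV_v :: "'a::field \<Rightarrow> 4 \<Rightarrow> 'a" where
  "EV_v a i = (if i = 0 then a else if i = 1 then 0 else 1)"

lift_definition sl2_mk :: "'a::field \<Rightarrow> 'a \<Rightarrow> 'a \<Rightarrow> 'a sl2" is
  "\<lambda>p q r. vector [vector [p, q], vector [r, - p]]"
  by (simp add: trace_def sum_2)

lemma sl2_mk_cong: "p = p' \<Longrightarrow> q = q' \<Longrightarrow> r = r' \<Longrightarrow> sl2_mk p q r = sl2_mk p' q' r'"
  by simp

lemma sl2_mk_simps:
  "sl2_bracket (sl2_mk p q r) (sl2_mk p' q' r') =
     sl2_mk (q * r' - q' * r) (2 * (p * q' - p' * q)) (2 * (r * p' - r' * p))"
  "sl2_scale c (sl2_mk p q r) = sl2_mk (c * p) (c * q) (c * r)"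
  "sl2_mk p q r + sl2_mk p' q' r' = sl2_mk (p + p') (q + q') (r + r')"
  "sl2_mk p q r - sl2_mk p' q' r' = sl2_mk (p - p') (q - q') (r - r')"
  "(0 :: 'a::field sl2) = sl2_mk 0 0 0"
  "(sl2_e :: 'a sl2) = sl2_mk 0 1 0" "(sl2_f :: 'a sl2) = sl2_mk 0 0 1"
  "(sl2_h :: 'a sl2) = sl2_mk 1 0 0"
  by (transfer, simp add: vec_eq_iff matrix_matrix_mult_def sum_2 forall_2 algebra_simps)+

definition EV_gen :: "'a::field \<Rightarrow> 4 \<Rightarrow> 4 \<Rightarrow> 'a sl2" where
  "EV_gen a i j =
     (let u = EV_u i; v = EV_v a i; u' = EV_u j; v' = EV_v a j in
      sl2_scale (inverse (u' * v - u * v')) (sl2_mk (u * v' + v * u') (- 2 * u * u') (2 * v * v')))"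

lemma EV_det:
  assumes "i \<noteq> j" "a \<noteq> 0" "a \<noteq> (1 :: 'a::field)"
  shows "EV_u j * EV_v a i - EV_u i * EV_v a j \<noteq> 0"
  using index_cases[of i] index_cases[of j] assms by (auto simp: EV_u_def EV_v_def)

lemma sl2_ad_cube:
  fixes p q r :: "'a::field"
  assumes "p * p + q * r = 1" and M: "M = sl2_mk p q r"
  shows "sl2_bracket M (sl2_bracket M (sl2_bracket M N)) = sl2_scale 4 (sl2_bracket M N)"
proof -
  have "\<exists>p' q' r'. N = sl2_mk p' q' r'"
  proof (transfer)
    fix N :: "'a^2^2" assume "trace N = 0"
    then have "N $ 2 $ 2 = - (N $ 1 $ 1)" by (simp add: trace_def sum_2 add_eq_0_iff)
    then have "N = vector [vector [N $ 1 $ 1, N $ 1 $ 2], vector [N $ 2 $ 1, - (N $ 1 $ 1)]]"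
      by (simp add: vec_eq_iff forall_2)
    then show "\<exists>p' q' r'. N = vector [vector [p', q'], vector [r', - p']]" by blast
  qed
  then obtain p' q' r' where N: "N = sl2_mk p' q' r'" by blast
  have qr: "q * r = 1 - p * p" using assms(1) by (simp add: algebra_simps)
  show ?thesis unfolding M N sl2_mk_simps
    by (rule sl2_mk_cong; use qr in algebra)
qed

lemma EV_ex1:
  fixes a :: "'a::field"
  assumes a: "a \<noteq> 0" "a \<noteq> 1"
  shows "\<exists>!\<phi>. lie_hom tet_scale tet_bracket sl2_scale sl2_bracket \<phi> \<and>
    (\<forall>i j. i \<noteq> j \<longrightarrow> \<phi> (tet_x i j) = EV_gen a i j)"
proof (rule tet_universal[OF lie_algebra_sl2])
  fix i j :: 4 assume "i \<noteq> j"
  from EV_det[OF this a] show "EV_gen a i j + EV_gen a j i = 0"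
    unfolding EV_gen_def Let_def sl2_mk_simps
    by (intro sl2_mk_cong) (auto simp: field_simps)
next
  fix i j k :: 4 assume "distinct [i, j, k]"
  then have "i \<noteq> j" "j \<noteq> k" "i \<noteq> k" by auto
  note d = this[THEN EV_det, OF a]
  define D where "D = EV_u j * EV_v a i - EV_u i * EV_v a j"
  define E where "E = EV_u k * EV_v a j - EV_u j * EV_v a k"
  have DE: "D * inverse D = 1" "E * inverse E = 1" using d by (simp_all add: D_def E_def)
  show "sl2_bracket (EV_gen a i j) (EV_gen a j k) =
      sl2_scale 2 (EV_gen a i j) + sl2_scale 2 (EV_gen a j k)"
    unfolding EV_gen_def Let_def sl2_mk_simps D_def[symmetric] E_def[symmetric]
    by (rule sl2_mk_cong; use DE D_def E_def in algebra)
next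
  fix i j k l :: 4 assume "distinct [i, j, k, l]"
  then have "i \<noteq> j" by auto
  note d = EV_det[OF this a]
  define D where "D = EV_u j * EV_v a i - EV_u i * EV_v a j"
  have D: "D * inverse D = 1" using d by (simp add: D_def)
  show "sl2_bracket (EV_gen a i j) (sl2_bracket (EV_gen a i j) (sl2_bracket (EV_gen a i j) (EV_gen a k l)))
      = sl2_scale 4 (sl2_bracket (EV_gen a i j) (EV_gen a k l))"
  proof (rule sl2_ad_cube)
    show "EV_gen a i j = sl2_mk (inverse D * (EV_u i * EV_v a j + EV_v a i * EV_u j))
        (inverse D * (- 2 * EV_u i * EV_u j)) (inverse D * (2 * EV_v a i * EV_v a j))"
      by (simp only: EV_gen_def Let_def sl2_mk_simps D_def)
    show "inverse D * (EV_u i * EV_v a j + EV_v a i * EV_u j) *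
        (inverse D * (EV_u i * EV_v a j + EV_v a i * EV_u j)) +
        inverse D * (- 2 * EV_u i * EV_u j) * (inverse D * (2 * EV_v a i * EV_v a j)) = 1"
      using D D_def by algebra
  qed
qed

lemma EV_gen_values:
  fixes a :: "'a::field"
  assumes a: "a \<noteq> 0" "a \<noteq> 1"
  shows "EV_gen a 1 2 = sl2_x" "EV_gen a 2 3 = sl2_y" "EV_gen a 3 1 = sl2_z"
    and "EV_gen a 0 3 = sl2_scale a sl2_y + sl2_scale (a - 1) sl2_z"
    and "EV_gen a 0 1 = sl2_scale (1 - inverse a) sl2_z - sl2_scale (inverse a) sl2_x"
    and "EV_gen a 0 2 = sl2_scale (inverse (1 - a)) sl2_x + sl2_scale (a * inverse (1 - a)) sl2_y"
proof -
  have 1: "inverse (a - 1) = - inverse (1 - a)" by (metis inverse_minus_eq minus_diff_eq)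
  have 2: "1 - a \<noteq> 0" using a by simp
  note d = EV_gen_def EV_u_def EV_v_def Let_def sl2_x_def sl2_y_def sl2_z_def sl2_mk_simps
  show "EV_gen a 1 2 = sl2_x" "EV_gen a 2 3 = sl2_y" "EV_gen a 3 1 = sl2_z"
    "EV_gen a 0 3 = sl2_scale a sl2_y + sl2_scale (a - 1) sl2_z"
    by (simp_all add: d mult.commute)
  show "EV_gen a 0 1 = sl2_scale (1 - inverse a) sl2_z - sl2_scale (inverse a) sl2_x"
    using a by (simp add: d algebra_simps)
  show "EV_gen a 0 2 =
      sl2_scale (inverse (1 - a)) sl2_x + sl2_scale (a * inverse (1 - a)) sl2_y"
    by (simp add: d 1, intro sl2_mk_cong) (use 2 in \<open>simp_all add: field_simps\<close>)
qed

lemma EV: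
  fixes a :: "'a::field"
  assumes "a \<noteq> 0" "a \<noteq> 1"
  shows "lie_hom tet_scale tet_bracket sl2_scale sl2_bracket (EV a)"
    and "EV a (tet_x 1 2) = sl2_x" "EV a (tet_x 2 3) = sl2_y" "EV a (tet_x 3 1) = sl2_z"
    and "EV a (tet_x 0 3) = sl2_scale a sl2_y + sl2_scale (a - 1) sl2_z"
    and "EV a (tet_x 0 1) = sl2_scale (1 - inverse a) sl2_z - sl2_scale (inverse a) sl2_x"
    and "EV a (tet_x 0 2) = sl2_scale (inverse (1 - a)) sl2_x + sl2_scale (a * inverse (1 - a)) sl2_y"
proof -
  let ?hom = "lie_hom tet_scale tet_bracket sl2_scale sl2_bracket :: ('a tet \<Rightarrow> _) \<Rightarrow> bool"
  let ?P = "\<lambda>\<phi>. ?hom \<phi> \<and>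
     \<phi> (tet_x 1 2) = sl2_x \<and> \<phi> (tet_x 2 3) = sl2_y \<and> \<phi> (tet_x 3 1) = sl2_z \<and>
     \<phi> (tet_x 0 3) = sl2_scale a sl2_y + sl2_scale (a - 1) sl2_z \<and>
     \<phi> (tet_x 0 1) = sl2_scale (1 - inverse a) sl2_z - sl2_scale (inverse a) sl2_x \<and>
     \<phi> (tet_x 0 2) = sl2_scale (inverse (1 - a)) sl2_x + sl2_scale (a * inverse (1 - a)) sl2_y"
  have iff: "?P \<phi> \<longleftrightarrow> ?hom \<phi> \<and> (\<forall>i j. i \<noteq> j \<longrightarrow> \<phi> (tet_x i j) = EV_gen a i j)" for \<phi>
  proof
    assume "?hom \<phi> \<and> (\<forall>i j. i \<noteq> j \<longrightarrow> \<phi> (tet_x i j) = EV_gen a i j)"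
    then show "?P \<phi>" by (simp add: EV_gen_values[OF assms])
  next
    assume P: "?P \<phi>"
    then interpret lie_hom tet_scale tet_bracket sl2_scale sl2_bracket \<phi> by blast
    obtain \<psi> where \<psi>: "?hom \<psi>" "\<And>i j. i \<noteq> j \<Longrightarrow> \<psi> (tet_x i j) = EV_gen a i j"
      using EV_ex1[OF assms] by blast
    interpret \<psi>: lie_hom tet_scale tet_bracket sl2_scale sl2_bracket \<psi> by (rule \<psi>)
    have "tet_x i j = - (tet_x j i :: 'a tet)" if "i \<noteq> j" for i j
      using tet_relations(1)[OF that] by (rule eq_neg_iff_add_eq_0[THEN iffD2])
    then have sw: "\<phi> (tet_x i j) = EV_gen a i j" if "\<phi> (tet_x j i) = EV_gen a j i" "i \<noteq> j" for i j
      using that \<psi>(2) neg \<psi>.neg by metis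
    have v: "\<phi> (tet_x 1 2) = EV_gen a 1 2" "\<phi> (tet_x 2 3) = EV_gen a 2 3"
      "\<phi> (tet_x 3 1) = EV_gen a 3 1" "\<phi> (tet_x 0 3) = EV_gen a 0 3"
      "\<phi> (tet_x 0 1) = EV_gen a 0 1" "\<phi> (tet_x 0 2) = EV_gen a 0 2"
      using P by (simp_all add: EV_gen_values[OF assms])
    have "\<phi> (tet_x i j) = EV_gen a i j" if "i \<noteq> j" for i j
      using that index_cases[of i] index_cases[of j] v v[THEN sw] by auto
    then show "?hom \<phi> \<and> (\<forall>i j. i \<noteq> j \<longrightarrow> \<phi> (tet_x i j) = EV_gen a i j)" using P by blast
  qed
  have "\<exists>!\<phi>. ?P \<phi>" unfolding iff by (rule EV_ex1[OF assms])
  from theI'[OF this, folded EV_def]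
  show "?hom (EV a)"
    and "EV a (tet_x 1 2) = sl2_x" "EV a (tet_x 2 3) = sl2_y" "EV a (tet_x 3 1) = sl2_z"
    and "EV a (tet_x 0 3) = sl2_scale a sl2_y + sl2_scale (a - 1) sl2_z"
    and "EV a (tet_x 0 1) = sl2_scale (1 - inverse a) sl2_z - sl2_scale (inverse a) sl2_x"
    and "EV a (tet_x 0 2) = sl2_scale (inverse (1 - a)) sl2_x + sl2_scale (a * inverse (1 - a)) sl2_y"
    by blast+
qed

text \<open>The action of the tetrahedron algebra on \<open>V\<^sub>d(a)\<close>, where \<open>act\<close> is the action of \<open>sl\<^sub>2\<close> on
  \<open>V\<^sub>d\<close>.\<close>

definition EV_pullback :: "'a::field \<Rightarrow> ('a sl2 \<Rightarrow> 'v \<Rightarrow> 'v) \<Rightarrow> 'a tet \<Rightarrow> 'v \<Rightarrow> 'v" where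
  "EV_pullback a act \<xi> = act (EV a \<xi>)"


section \<open>The action of \<open>S\<^sub>4\<close> on the scalars other than 0 and 1\<close>

definition is_S4_action :: "((4 \<Rightarrow> 4) \<Rightarrow> 'a::field \<Rightarrow> 'a) \<Rightarrow> bool" where
  "is_S4_action \<alpha> \<longleftrightarrow>
     (\<forall>\<sigma> a. bij \<sigma> \<and> a \<notin> {0, 1} \<longrightarrow> \<alpha> \<sigma> a \<notin> {0, 1}) \<and>
     (\<forall>a. a \<notin> {0, 1} \<longrightarrow> \<alpha> id a = a) \<and>
     (\<forall>\<sigma> \<tau> a. bij \<sigma> \<and> bij \<tau> \<and> a \<notin> {0, 1} \<longrightarrow> \<alpha> (\<sigma> \<circ> \<tau>) a = \<alpha> \<sigma> (\<alpha> \<tau> a)) \<and>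
     (\<forall>a. a \<notin> {0, 1} \<longrightarrow>
        \<alpha> (Transposition.transpose 2 0) a = inverse a \<and>
        \<alpha> (Transposition.transpose 0 1) a = a * inverse (a - 1) \<and>
        \<alpha> (Transposition.transpose 1 3) a = inverse a)"

text \<open>Such an \<open>\<alpha>\<close> exists, and its values at permutations and scalars other than 0 and 1 are
  unique; see \<open>is_S4_action_S4_act\<close> and \<open>is_S4_action_unique\<close>.\<close>

definition S4_act :: "(4 \<Rightarrow> 4) \<Rightarrow> 'a::field \<Rightarrow> 'a" where
  "S4_act = (SOME \<alpha>. is_S4_action \<alpha>)"

lemma is_S4_actionD:
  assumes "is_S4_action \<alpha>"
  shows "bij \<sigma> \<Longrightarrow> a \<notin> {0, 1} \<Longrightarrow> \<alpha> \<sigma> a \<notin> {0, 1}"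
    and "a \<notin> {0, 1} \<Longrightarrow> \<alpha> id a = a"
    and "bij \<sigma> \<Longrightarrow> bij \<tau> \<Longrightarrow> a \<notin> {0, 1} \<Longrightarrow> \<alpha> (\<sigma> \<circ> \<tau>) a = \<alpha> \<sigma> (\<alpha> \<tau> a)"
    and "a \<notin> {0, 1} \<Longrightarrow> \<alpha> (Transposition.transpose 2 0) a = inverse a"
    and "a \<notin> {0, 1} \<Longrightarrow> \<alpha> (Transposition.transpose 0 1) a = a * inverse (a - 1)"
    and "a \<notin> {0, 1} \<Longrightarrow> \<alpha> (Transposition.transpose 1 3) a = inverse a"
  using assms unfolding is_S4_action_def by blast+

lemma is_S4_action_unique:
  fixes \<alpha> \<beta> :: "(4 \<Rightarrow> 4) \<Rightarrow> 'a::field \<Rightarrow> 'a"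
  assumes "is_S4_action \<alpha>" "is_S4_action \<beta>" "bij \<sigma>" "a \<notin> {0, 1}"
  shows "\<alpha> \<sigma> a = \<beta> \<sigma> a"
proof -
  let ?t = "Transposition.transpose :: 4 \<Rightarrow> 4 \<Rightarrow> 4 \<Rightarrow> 4"
  define P where "P \<sigma> \<longleftrightarrow> bij \<sigma> \<and> (\<forall>a. a \<notin> {0, 1} \<longrightarrow> \<alpha> \<sigma> a = \<beta> \<sigma> a)" for \<sigma>
  note D = is_S4_actionD[OF assms(1)] is_S4_actionD[OF assms(2)]
  have id: "P id" by (simp add: P_def D)
  have comp: "P (\<sigma> \<circ> \<tau>)" if "P \<sigma>" "P \<tau>" for \<sigma> \<tau>
  proof -
    have b: "bij \<sigma>" "bij \<tau>" using that by (simp_all add: P_def)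
    have "\<alpha> (\<sigma> \<circ> \<tau>) a = \<beta> (\<sigma> \<circ> \<tau>) a" if a: "a \<notin> {0, 1}" for a
    proof -
      have "\<alpha> (\<sigma> \<circ> \<tau>) a = \<alpha> \<sigma> (\<alpha> \<tau> a)" "\<beta> (\<sigma> \<circ> \<tau>) a = \<beta> \<sigma> (\<beta> \<tau> a)" "\<alpha> \<tau> a \<notin> {0, 1}"
        by (rule D b a)+
      with \<open>P \<sigma>\<close> \<open>P \<tau>\<close> a show ?thesis unfolding P_def by metis
    qed
    with b show ?thesis by (simp add: P_def bij_comp)
  qed
  have g: "P (?t 2 0)" "P (?t 0 1)" "P (?t 1 3)"
    by (simp_all add: P_def D)
  have conj: "P (?t i k)" if "P (?t i j)" "P (?t j k)" "distinct [i, j, k]" for i j k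
  proof -
    have "?t i k = ?t i j \<circ> ?t j k \<circ> ?t i j"
      using that(3) by (auto simp: fun_eq_iff Transposition.transpose_def)
    with that comp show ?thesis by metis
  qed
  have "P (?t 2 1)" by (rule conj[OF g(1,2)]) simp
  moreover have "P (?t 0 3)" by (rule conj[OF g(2,3)]) simp
  moreover have "P (?t 2 3)" by (rule conj[OF \<open>P (?t 2 1)\<close> g(3)]) simp
  ultimately have t: "P (?t i j)" if "i \<noteq> j" for i j
    using that index_cases[of i] index_cases[of j] g by (auto simp: Transposition.transpose_commute)
  have "\<sigma> permutes UNIV" using \<open>bij \<sigma>\<close> by (simp add: permutes_univ bij_iff)
  from this finite[of UNIV] have "P \<sigma>"
  proof (induction rule: permutes_induct)
    case (swap i j \<tau>)
    then show ?case by (intro comp t)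
  qed (rule id)
  with assms(4) show ?thesis by (simp add: P_def)
qed

definition S4_W :: "'a::field \<Rightarrow> 4 \<Rightarrow> 4 \<Rightarrow> 'a" where
  "S4_W a i j = (if {i, j} \<in> {{0, 1}, {2, 3}} then a
     else if {i, j} \<in> {{0, 2}, {1, 3}} then 1 - a else - 1)"

lemma S4_W_swap: "distinct [i, j, k, l] \<Longrightarrow> S4_W a i j = S4_W a k l"
  using index_cases[of i] index_cases[of j] index_cases[of k] index_cases[of l]
  by (elim disjE) (simp_all add: S4_W_def doubleton_eq_iff)

lemma S4_W_sum: "distinct [i, j, k, l] \<Longrightarrow> S4_W a i j + S4_W a i k + S4_W a i l = 0"
  using index_cases[of i] index_cases[of j] index_cases[of k] index_cases[of l]
  by (elim disjE) (simp_all add: S4_W_def doubleton_eq_iff)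

lemma S4_W_nonzero: "a \<notin> {0, 1} \<Longrightarrow> S4_W a i j \<noteq> 0"
  by (auto simp: S4_W_def)

lemma S4_W_commute: "S4_W a i j = S4_W a j i"
  by (simp add: S4_W_def insert_commute)

lemma is_S4_action_ex: "\<exists>\<alpha> :: _ \<Rightarrow> 'a::field \<Rightarrow> 'a. is_S4_action \<alpha>"
proof -
  define \<alpha> where "\<alpha> \<sigma> a = - S4_W a (inv \<sigma> 0) (inv \<sigma> 1) / S4_W a (inv \<sigma> 0) (inv \<sigma> 3)"
    for \<sigma> :: "4 \<Rightarrow> 4" and a :: 'a
  have W: "S4_W (\<alpha> \<sigma> a) i j = - S4_W a (inv \<sigma> i) (inv \<sigma> j) / S4_W a (inv \<sigma> 0) (inv \<sigma> 3)"
    if "bij \<sigma>" "a \<notin> {0, 1}" "i \<noteq> j" for \<sigma> a i j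
  proof -
    let ?s = "inv \<sigma>" and ?W = "S4_W a"
    have "inj ?s" using \<open>bij \<sigma>\<close> by (simp add: bij_imp_bij_inv bij_is_inj)
    then have s: "distinct [?s 0, ?s 1, ?s 2, ?s 3]" by (simp add: inj_eq)
    have nz: "?W i j \<noteq> 0" for i j using S4_W_nonzero[OF that(2)] .
    have e: "?W (?s 2) (?s 3) = ?W (?s 0) (?s 1)" "?W (?s 1) (?s 3) = ?W (?s 0) (?s 2)"
      "?W (?s 1) (?s 2) = ?W (?s 0) (?s 3)"
      using s by (auto intro!: S4_W_swap)
    have "?W (?s 0) (?s 1) + ?W (?s 0) (?s 2) + ?W (?s 0) (?s 3) = 0"
      using s by (auto intro!: S4_W_sum)
    then have su: "?W (?s 0) (?s 2) = - ?W (?s 0) (?s 1) - ?W (?s 0) (?s 3)"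
      by (simp add: algebra_simps add_eq_0_iff)
    have a1: "S4_W b 0 1 = b" "S4_W b 2 3 = b" "S4_W b 0 2 = 1 - b" "S4_W b 1 3 = 1 - b"
      "S4_W b 0 3 = - 1" "S4_W b 1 2 = - 1" for b :: 'a
      by (simp_all add: S4_W_def doubleton_eq_iff)
    have "S4_W (\<alpha> \<sigma> a) i j = - ?W (?s i) (?s j) / ?W (?s 0) (?s 3)"
      if "(i, j) \<in> {(0,1), (2,3), (0,2), (1,3), (0,3), (1,2)}" for i j
      using that nz by (auto simp: a1 e su \<alpha>_def diff_divide_distrib add_divide_distrib)
    moreover have "(i, j) \<in> {(0,1), (2,3), (0,2), (1,3), (0,3), (1,2)} \<or>
        (j, i) \<in> {(0,1), (2,3), (0,2), (1,3), (0,3), (1,2)}"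
      using index_cases[of i] index_cases[of j] \<open>i \<noteq> j\<close> by auto
    ultimately show ?thesis by (metis S4_W_commute)
  qed
  have d: "\<alpha> \<sigma> a \<notin> {0, 1}" if h: "bij \<sigma>" "a \<notin> {0, 1}" for \<sigma> a
  proof -
    have "S4_W (\<alpha> \<sigma> a) 0 1 \<noteq> 0" "S4_W (\<alpha> \<sigma> a) 0 2 \<noteq> 0"
      using S4_W_nonzero[OF h(2)] by (simp_all add: W[OF h])
    then show ?thesis by (auto simp: S4_W_def doubleton_eq_iff)
  qed
  have i: "\<alpha> id a = a" for a
    by (simp add: \<alpha>_def S4_W_def doubleton_eq_iff)
  have c: "\<alpha> (\<sigma> \<circ> \<tau>) a = \<alpha> \<sigma> (\<alpha> \<tau> a)" if h: "bij \<sigma>" "bij \<tau>" "a \<notin> {0, 1}" for \<sigma> \<tau> a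
  proof -
    have n: "inv \<sigma> 0 \<noteq> inv \<sigma> 1" "inv \<sigma> 0 \<noteq> inv \<sigma> 3"
      using bij_is_inj[OF bij_imp_bij_inv[OF h(1)]] by (simp_all add: inj_eq)
    show ?thesis
      unfolding \<alpha>_def[of \<sigma>] W[OF h(2,3) n(1)] W[OF h(2,3) n(2)]
        \<alpha>_def[of "\<sigma> \<circ> \<tau>"] o_inv_distrib[OF h(1,2)]
      using S4_W_nonzero[OF h(3)] by simp
  qed
  have t: "\<alpha> (Transposition.transpose 2 0) a = inverse a"
      "\<alpha> (Transposition.transpose 0 1) a = a * inverse (a - 1)"
      "\<alpha> (Transposition.transpose 1 3) a = inverse a" for a
    by (simp_all add: \<alpha>_def S4_W_def doubleton_eq_iff Transposition.transpose_def)
      (simp_all add: divide_inverse flip: inverse_minus_eq mult_minus_right)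
  have "is_S4_action \<alpha>"
    unfolding is_S4_action_def by (intro conjI allI impI; (elim conjE)?) (assumption | rule d i c t)+
  then show ?thesis by (rule exI[of _ \<alpha>])
qed

lemma is_S4_action_S4_act: "is_S4_action (S4_act :: _ \<Rightarrow> 'a::field \<Rightarrow> 'a)"
  unfolding S4_act_def using is_S4_action_ex by (rule someI_ex)

end

theory Submission
  imports Defs
begin

text \<open>\<open>EV a\<close> is determined by the four points \<open>a, 0, 1, \<infinity>\<close> of the projective line, indexed by
  \<open>0, 1, 2, 3\<close>: the generator $x_{ij}$ goes to the matrix with eigenvalues -1 and 1 at the points
  \<open>i\<close> and \<open>j\<close>. Permuting the points by \<open>\<sigma>\<close> amounts, up to a projective transformation, to
  replacing the cross ratio \<open>a\<close> by \<open>\<sigma>(a)\<close>, so \<open>EV a \<circ> \<sigma>\<inverse>\<close> is \<open>EV (\<sigma>(a))\<close> followed by a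
  conjugation of \<open>sl\<^sub>2\<close>. The conjugation does not matter, because all irreducible \<open>sl\<^sub>2\<close>-modules
  of the same finite dimension are isomorphic.\<close>

section \<open>Eigenvectors\<close>

text \<open>This is p(T) v in Horner form: the space as a module over the polynomial ring, with the
  variable acting as \<open>T\<close>.\<close>

definition poly_op :: "('a::comm_ring_1 \<Rightarrow> 'v \<Rightarrow> 'v) \<Rightarrow> ('v \<Rightarrow> 'v) \<Rightarrow> 'a poly \<Rightarrow> 'v \<Rightarrow> 'v::ab_group_add" where
  "poly_op s T p v = fold_coeffs (\<lambda>a w. s a v + T w) p 0"

context
  fixes s :: "'a::field \<Rightarrow> 'v::ab_group_add \<Rightarrow> 'v" and T
  assumes T: "Vector_Spaces.linear s s T"
begin

interpretation Vector_Spaces.linear s s T by (rule T)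

lemma poly_op_0: "poly_op s T 0 v = 0"
  by (simp add: poly_op_def)

lemma poly_op_pCons: "poly_op s T (pCons a p) v = s a v + T (poly_op s T p v)"
  \<comment> \<open>For \<open>pCons 0 0\<close> the coefficient list is empty and not
    \<open>[0]\<close>; there the equation rests on \<open>T 0 = 0\<close>.\<close>
  by (cases "p = 0 \<and> a = 0") (auto simp: poly_op_def zero)

lemma poly_op_add: "poly_op s T (p + q) v = poly_op s T p v + poly_op s T q v"
  by (induction p q rule: poly_induct2)
    (simp_all add: poly_op_0 poly_op_pCons add vs1.scale_left_distrib ac_simps)

lemma poly_op_smult: "poly_op s T (smult c p) v = s c (poly_op s T p v)"
  by (induction p) (simp_all add: poly_op_0 poly_op_pCons scale vs1.scale_right_distrib)

lemma poly_op_diff: "poly_op s T (p - q) v = poly_op s T p v - poly_op s T q v"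
  using poly_op_add[of "p - q" q v] by simp

lemma poly_op_monom: "poly_op s T (monom c n) v = s c ((T ^^ n) v)"
  by (induction n) (simp_all add: monom_0 monom_Suc poly_op_0 poly_op_pCons scale zero)

lemma poly_op_linear_factor:
  "poly_op s T ([:- c, 1:] * q) v = T (poly_op s T q v) - s c (poly_op s T q v)"
  by (simp add: poly_op_diff poly_op_smult poly_op_pCons)

text \<open>The values p(T) v with p of degree below n form a subspace that contains the iterates.
  The bound is put on coefficients because \<open>degree p < n\<close> would exclude the zero
  polynomial for n = 0.\<close>

lemma span_iterates_poly_op:
  assumes "x \<in> module.span s ((\<lambda>i. (T ^^ i) v) ` {..<n})"
  shows "\<exists>p. (\<forall>i\<ge>n. coeff p i = 0) \<and> x = poly_op s T p v"
proof -
  have "module.span s ((\<lambda>i. (T ^^ i) v) ` {..<n}) \<subseteq> {poly_op s T p v | p. \<forall>i\<ge>n. coeff p i = 0}"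
  proof (rule vs1.span_minimal)
    show "(\<lambda>i. (T ^^ i) v) ` {..<n} \<subseteq> {poly_op s T p v | p. \<forall>i\<ge>n. coeff p i = 0}"
    proof clarify
      fix i assume "i < n"
      then show "\<exists>p. (T ^^ i) v = poly_op s T p v \<and> (\<forall>i\<ge>n. coeff p i = 0)"
        by (intro exI[of _ "monom 1 i"]) (simp add: poly_op_monom)
    qed
    show "module.subspace s {poly_op s T p v | p. \<forall>i\<ge>n. coeff p i = 0}"
    proof (rule vs1.subspaceI)
      show "0 \<in> {poly_op s T p v | p. \<forall>i\<ge>n. coeff p i = 0}"
        using poly_op_0 by (auto intro!: exI[of _ 0])
    next
      fix x y assume "x \<in> {poly_op s T p v | p. \<forall>i\<ge>n. coeff p i = 0}"
        "y \<in> {poly_op s T p v | p. \<forall>i\<ge>n. coeff p i = 0}"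
      then obtain p q where "x = poly_op s T p v" "y = poly_op s T q v"
        "\<forall>i\<ge>n. coeff p i = 0" "\<forall>i\<ge>n. coeff q i = 0" by blast
      then show "x + y \<in> {poly_op s T p v | p. \<forall>i\<ge>n. coeff p i = 0}"
        by (auto simp: poly_op_add intro!: exI[of _ "p + q"])
    next
      fix c x assume "x \<in> {poly_op s T p v | p. \<forall>i\<ge>n. coeff p i = 0}"
      then obtain p where "x = poly_op s T p v" "\<forall>i\<ge>n. coeff p i = 0" by blast
      then show "s c x \<in> {poly_op s T p v | p. \<forall>i\<ge>n. coeff p i = 0}"
        by (auto simp: poly_op_smult intro!: exI[of _ "smult c p"])
    qed
  qed
  with assms show ?thesis by blast
qed

end

text \<open>\<open>dim\<close> is the \<open>card\<close> of a basis, and \<open>card\<close> is 0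
  on infinite sets; so a nonzero \<open>dim\<close> expresses finite dimension.\<close>

lemma (in vector_space) finite_basis_of_dim:
  assumes "dim UNIV \<noteq> 0"
  obtains B where "finite B" "independent B" "span B = UNIV"
proof -
  obtain B where B: "independent B" "UNIV \<subseteq> span B" "card B = dim UNIV"
    using basis_exists[of UNIV] by metis
  with assms have "finite B" by (metis card.infinite)
  then show thesis using that[of B] B by auto
qed

text \<open>Otherwise every prefix of the sequence would be independent without repetitions, and a
  prefix one longer than a finite basis contradicts the exchange bound.\<close>

lemma (in vector_space) exists_in_span_previous:
  fixes w :: "nat \<Rightarrow> 'b"
  assumes "dim UNIV \<noteq> 0"
  shows "\<exists>n. w n \<in> span (w ` {..<n})"
proof (rule ccontr)
  assume no: "\<not> ?thesis"
  have ind: "independent (w ` {..<n}) \<and> card (w ` {..<n}) = n" for n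
  proof (induction n)
    case 0
    show ?case by (simp add: independent_empty)
  next
    case (Suc n)
    have sp: "w n \<notin> span (w ` {..<n})" using no by simp
    then have "w n \<notin> w ` {..<n}" by (rule contrapos_nn) (rule span_base)
    with Suc sp show ?case by (simp add: lessThan_Suc independent_insert)
  qed
  obtain B where B: "finite B" "independent B" "span B = UNIV"
    by (rule finite_basis_of_dim[OF assms])
  have "w ` {..<Suc (card B)} \<subseteq> span B" unfolding B(3) by (rule subset_UNIV)
  from independent_span_bound[OF B(1) _ this] ind[of "Suc (card B)"] show False
    by linarith
qed

text \<open>Some nonzero p has p(T) v = 0. Splitting off a root c, p = (x - c) q, either q(T) v = 0
  and the degree drops, or q(T) v is an eigenvector for c.\<close>

lemma exists_eigenvector:
  fixes s :: "'a::alg_closed_field \<Rightarrow> 'v::ab_group_add \<Rightarrow> 'v"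
  assumes T: "Vector_Spaces.linear s s T" and dim: "vector_space.dim s (UNIV :: 'v set) \<noteq> 0"
  shows "\<exists>c v. v \<noteq> 0 \<and> T v = s c v"
proof -
  interpret Vector_Spaces.linear s s T by (rule T)
  have "\<exists>v::'v. v \<noteq> 0"
  proof (rule ccontr)
    assume "\<not> ?thesis"
    then have "(UNIV :: 'v set) = {0}" by auto
    with dim vs1.dim_le_card[of UNIV "{}"] show False by simp
  qed
  then obtain v :: 'v where v: "v \<noteq> 0" by blast
  obtain n where n: "(T ^^ n) v \<in> vs1.span ((\<lambda>i. (T ^^ i) v) ` {..<n})"
    using vs1.exists_in_span_previous[OF dim, of "\<lambda>i. (T ^^ i) v"] by blast
  obtain q where q: "\<forall>i\<ge>n. coeff q i = 0" "(T ^^ n) v = poly_op s T q v"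
    using span_iterates_poly_op[OF T n] by blast
  \<comment> \<open>\<open>q\<close> has no coefficient from n on, so the leading term of x^n - q
    survives.\<close>
  have "coeff (monom 1 n - q) n \<noteq> 0" using q(1) by simp
  then have "monom 1 n - q \<noteq> 0" by (metis coeff_0)
  moreover have "poly_op s T (monom 1 n - q) v = 0"
    by (simp add: poly_op_diff[OF T] poly_op_monom[OF T] q(2))
  ultimately obtain p where "p \<noteq> 0" "poly_op s T p v = 0" by blast
  then show ?thesis
  proof (induction "degree p" arbitrary: p rule: less_induct)
    case less
    show ?case
    proof (cases "degree p = 0")
      case True
      then obtain b where "p = [:b:]" by (metis degree_eq_zeroE)
      with less.prems v show ?thesis
        by (simp add: poly_op_pCons[OF T] poly_op_0[OF T] zero)
    next
      case False
      then obtain c where "poly p c = 0" using alg_closed_imp_poly_has_root by blast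
      then obtain q where p: "p = [:- c, 1:] * q" by (metis dvdE poly_eq_0_iff_dvd)
      with less.prems have "q \<noteq> 0" by auto
      then have deg: "degree q < degree p" unfolding p by (subst degree_mult_eq) auto
      show ?thesis
      proof (cases "poly_op s T q v = 0")
        case True
        from less.hyps[OF deg \<open>q \<noteq> 0\<close> True] show ?thesis .
      next
        case False
        with less.prems show ?thesis
          unfolding p poly_op_linear_factor[OF T] by auto
      qed
    qed
  qed
qed

text \<open>Coefficients are indexed by \<open>I\<close> and not by vectors, the form in which
  \<open>eigenvectors_sum_zero\<close> takes a linear relation.\<close>

lemma span_imageE:
  fixes w :: "'i \<Rightarrow> 'v::ab_group_add" and s :: "'a::field \<Rightarrow> 'v \<Rightarrow> 'v"
  assumes "vector_space s" "finite I" "x \<in> module.span s (w ` I)"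
  shows "\<exists>u. x = (\<Sum>i\<in>I. s (u i) (w i))"
proof -
  interpret vector_space s by fact
  from assms(2,3) show ?thesis
  proof (induction arbitrary: x)
    case (insert j I)
    from insert.prems obtain k where "x - s k (w j) \<in> span (w ` I)"
      by (auto simp: span_insert)
    from insert.IH[OF this] obtain u where "x - s k (w j) = (\<Sum>i\<in>I. s (u i) (w i))" by blast
    then have "x = s k (w j) + (\<Sum>i\<in>I. s (u i) (w i))" by (simp add: algebra_simps)
    also have "\<dots> = (\<Sum>i\<in>insert j I. s ((u(j := k)) i) (w i))"
      using insert.hyps by (auto intro!: sum.cong)
    finally show ?case by blast
  qed simp
qed

text \<open>Proof: if the sum with coefficients \<open>u\<close> vanishes, then \<open>T - c j\<close> maps it to a sum that
  does not involve the index \<open>j\<close>.\<close>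

lemma eigenvectors_sum_zero:
  fixes w :: "'i \<Rightarrow> 'v::ab_group_add" and s :: "'a::field \<Rightarrow> 'v \<Rightarrow> 'v"
  assumes T: "Vector_Spaces.linear s s T" and "finite I" and "inj_on c I"
    and "\<And>i. i \<in> I \<Longrightarrow> T (w i) = s (c i) (w i)"
    and "\<And>i. i \<in> I \<Longrightarrow> w i \<noteq> 0"
    and "(\<Sum>i\<in>I. s (u i) (w i)) = 0"
  shows "\<forall>i\<in>I. u i = 0"
proof -
  interpret Vector_Spaces.linear s s T by (rule T)
  from assms(2-6) show ?thesis
  proof (induction arbitrary: u)
    case (insert j I)
    let ?S = "\<Sum>i\<in>insert j I. s (u i) (w i)"
    have "T ?S - s (c j) ?S = (\<Sum>i\<in>insert j I. s (u i * (c i - c j)) (w i))"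
      unfolding sum vs1.scale_sum_right sum_subtractf[symmetric]
      using insert.prems(2)
      by (intro sum.cong) (auto simp: scale vs1.scale_left_diff_distrib algebra_simps)
    also have "\<dots> = (\<Sum>i\<in>I. s (u i * (c i - c j)) (w i))"
      using insert.hyps by simp
    finally have "(\<Sum>i\<in>I. s (u i * (c i - c j)) (w i)) = 0"
      using insert.prems(4) zero by simp
    then have "\<forall>i\<in>I. u i * (c i - c j) = 0"
      using insert.prems by (intro insert.IH) (auto simp: inj_on_def)
    then have I: "\<forall>i\<in>I. u i = 0"
      using insert.prems(1) insert.hyps(2) by (auto simp: inj_on_def)
    then have "s (u j) (w j) = 0"
      using insert.prems(4) insert.hyps by simp
    with I insert.prems(3) show ?case by auto
  qed simp
qed

section \<open>Independence of eigenvectors for distinct eigenvalues\<close>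

text \<open>A vector in the span of the earlier ones gives a relation with coefficient -1 at that
  vector, against \<open>eigenvectors_sum_zero\<close>. Injectivity is stated as well because
  independence of the image set does not exclude repetitions.\<close>

lemma eigenvectors_independent:
  fixes w :: "nat \<Rightarrow> 'v::ab_group_add" and s :: "'a::field \<Rightarrow> 'v \<Rightarrow> 'v"
  assumes T: "Vector_Spaces.linear s s T" and "inj_on c {..<n}"
    and "\<And>i. i < n \<Longrightarrow> T (w i) = s (c i) (w i)"
    and "\<And>i. i < n \<Longrightarrow> w i \<noteq> 0"
  shows "\<not> module.dependent s (w ` {..<n}) \<and> inj_on w {..<n}"
  using assms(2-4)
proof (induction n)
  interpret Vector_Spaces.linear s s T by (rule T)
  {
    case 0
    show ?case by (simp add: vs1.independent_empty)
  next
    case (Suc n)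
    then have IH: "vs1.independent (w ` {..<n})" "inj_on w {..<n}"
      by (simp_all add: lessThan_Suc)
    have no: "w n \<notin> vs1.span (w ` {..<n})"
    proof
      assume "w n \<in> vs1.span (w ` {..<n})"
      from span_imageE[OF vs1.vector_space_axioms finite_lessThan this] obtain u
        where u: "w n = (\<Sum>i<n. s (u i) (w i))" by blast
      have "(\<Sum>i<Suc n. s ((u(n := - 1)) i) (w i)) = 0"
        using u by simp
      from eigenvectors_sum_zero[OF T finite_lessThan Suc.prems(1) _ _ this] Suc.prems(2,3)
      have "\<forall>i\<in>{..<Suc n}. (u(n := - 1)) i = 0" by blast
      then have "(u(n := - 1)) n = 0" by (rule bspec) auto
      then show False by simp
    qed
    from no have "w n \<notin> w ` {..<n}" by (rule contrapos_nn) (rule vs1.span_base)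
    with no IH show ?case by (simp add: lessThan_Suc vs1.independent_insert)
  }
qed

text \<open>In finite dimension only finitely many eigenvalues occur. This is what ends the chains
  of iterates of \<open>sl2_e\<close> and \<open>sl2_f\<close>, whose weights are distinct in
  characteristic 0.\<close>

lemma eigenvectors_vanish:
  fixes w :: "nat \<Rightarrow> 'v::ab_group_add" and s :: "'a::field \<Rightarrow> 'v \<Rightarrow> 'v"
  assumes T: "Vector_Spaces.linear s s T" and "vector_space.dim s (UNIV :: 'v set) \<noteq> 0"
    and "inj c" and "\<And>i. T (w i) = s (c i) (w i)"
  shows "\<exists>n. w n = 0"
proof (rule ccontr)
  assume nz: "\<not> ?thesis"
  interpret Vector_Spaces.linear s s T by (rule T)
  obtain n where n: "w n \<in> vs1.span (w ` {..<n})"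
    using vs1.exists_in_span_previous[OF assms(2)] by blast
  have "vs1.independent (w ` {..<Suc n}) \<and> inj_on w {..<Suc n}"
  proof (rule eigenvectors_independent[OF T])
    show "inj_on c {..<Suc n}" using \<open>inj c\<close> by (rule inj_on_subset) simp
    show "T (w i) = s (c i) (w i)" "w i \<noteq> 0" for i using assms(4) nz by blast+
  qed
  then have "vs1.independent (insert (w n) (w ` {..<n}))" "w n \<notin> w ` {..<n}"
    by (simp_all add: lessThan_Suc)
  with n show False by (simp add: vs1.independent_insert)
qed

section \<open>Irreducible modules of \<open>sl\<^sub>2\<close>\<close>

lemma sl2_mk_cases:
  obtains p q r where "M = sl2_mk p q r"
proof (transfer fixing: thesis)
  fix M :: "'a^2^2" assume M: "trace M = 0"
    and *: "\<And>p q r. M = vector [vector [p, q], vector [r, - p]] \<Longrightarrow> thesis"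
  from M have "M $ 2 $ 2 = - (M $ 1 $ 1)" by (simp add: trace_def sum_2 add_eq_0_iff)
  then have "M = vector [vector [M $ 1 $ 1, M $ 1 $ 2], vector [M $ 2 $ 1, - (M $ 1 $ 1)]]"
    by (simp add: vec_eq_iff forall_2)
  then show thesis by (rule *)
qed

lemma sl2_mk_eq_efh:
  "sl2_mk p q r = sl2_scale p sl2_h + sl2_scale q sl2_e + sl2_scale r sl2_f"
  by (simp add: sl2_mk_simps)

section \<open>Weights and highest weight vectors\<close>

locale sl2_module = lie_module sl2_scale sl2_bracket s act
  for s :: "'a::field_char_0 \<Rightarrow> 'v::ab_group_add \<Rightarrow> 'v" and act :: "'a sl2 \<Rightarrow> 'v \<Rightarrow> 'v"
begin

lemma linear_act: "Vector_Spaces.linear s s (act x)"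
  by unfold_locales (simp_all add: act_add_right act_scale_right)

lemma act_zero [simp]: "act x 0 = 0"
  using act_scale_right[of x 0 0] by simp

lemma act_sl2_mk:
  "act (sl2_mk p q r) v = s p (act sl2_h v) + s q (act sl2_e v) + s r (act sl2_f v)"
  by (simp add: sl2_mk_eq_efh act_add_left act_scale_left)

lemma act_h_e: "act sl2_h (act sl2_e v) = act sl2_e (act sl2_h v) + s 2 (act sl2_e v)"
  using act_bracket[of sl2_h sl2_e v] by (simp add: sl2_ef_brackets act_scale_left algebra_simps)

lemma act_h_f: "act sl2_h (act sl2_f v) = act sl2_f (act sl2_h v) + s (- 2) (act sl2_f v)"
  using act_bracket[of sl2_h sl2_f v]
  by (simp only: sl2_ef_brackets act_scale_left) (simp add: algebra_simps)

lemma act_e_f: "act sl2_e (act sl2_f v) = act sl2_f (act sl2_e v) + act sl2_h v"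
  using act_bracket[of sl2_e sl2_f v] by (simp add: sl2_ef_brackets algebra_simps)

lemma h_e_power:
  assumes "act sl2_h v = s c v"
  shows "act sl2_h ((act sl2_e ^^ n) v) = s (c + 2 * of_nat n) ((act sl2_e ^^ n) v)"
  by (induction n)
    (simp_all add: assms act_h_e act_scale_right V.scale_left_distrib algebra_simps flip: V.scale_left_distrib)

lemma h_f_power:
  assumes "act sl2_h v = s c v"
  shows "act sl2_h ((act sl2_f ^^ n) v) = s (c - 2 * of_nat n) ((act sl2_f ^^ n) v)"
proof (induction n)
  case (Suc n)
  let ?w = "(act sl2_f ^^ Suc n) v"
  have "act sl2_h ?w = s (c - 2 * of_nat n) ?w + s (- 2) ?w"
    using Suc by (simp add: act_h_f act_scale_right)
  also have "\<dots> = s (c - 2 * of_nat (Suc n)) ?w"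
    by (simp add: algebra_simps flip: V.scale_left_distrib)
  finally show ?case .
qed (simp add: assms)

text \<open>Moving e past each f leaves one h, so the coefficient is the sum of the weights c, c -
  2, ..., c - 2n of the vectors v, f v, ..., f^n v.\<close>

lemma e_f_power:
  assumes "act sl2_h v = s c v" "act sl2_e v = 0"
  shows "act sl2_e ((act sl2_f ^^ Suc n) v) =
    s (of_nat (Suc n) * (c - of_nat n)) ((act sl2_f ^^ n) v)"
proof (induction n)
  case 0
  show ?case by (simp add: assms act_e_f)
next
  case (Suc n)
  let ?w = "(act sl2_f ^^ Suc n) v"
  have "act sl2_e ((act sl2_f ^^ Suc (Suc n)) v) = act sl2_f (act sl2_e ?w) + act sl2_h ?w"
    by (simp add: act_e_f)
  also have "\<dots> = s (of_nat (Suc n) * (c - of_nat n)) ?w + s (c - 2 * of_nat (Suc n)) ?w"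
    by (simp only: Suc.IH h_f_power[OF assms(1)]) (simp add: act_scale_right)
  also have "\<dots> = s (of_nat (Suc (Suc n)) * (c - of_nat (Suc n))) ?w"
    by (simp only: V.scale_left_distrib[symmetric]) (rule arg_cong[of _ _ "\<lambda>x. s x ?w"], simp add: algebra_simps)
  finally show ?case .
qed

text \<open>Stronger than the usual notion: v, f v, ..., f^d v must be a basis, so that the module
  is the standard model of \<open>V\<^sub>d\<close>.\<close>

definition highest_weight_vector :: "nat \<Rightarrow> 'v \<Rightarrow> bool" where
  "highest_weight_vector d v \<longleftrightarrow> act sl2_h v = s (of_nat d) v \<and> act sl2_e v = 0 \<and>
     (act sl2_f ^^ Suc d) v = 0 \<and> inj_on (\<lambda>i. (act sl2_f ^^ i) v) {..d} \<and>
     V.independent ((\<lambda>i. (act sl2_f ^^ i) v) ` {..d}) \<and>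
     V.span ((\<lambda>i. (act sl2_f ^^ i) v) ` {..d}) = UNIV"

end

text \<open>Raising an eigenvector of h by e until the next step gives 0 yields a vector of highest
  weight. The iterates of f on it span a nonzero submodule, which is everything by
  irreducibility.\<close>

lemma exists_highest_weight_vector:
  fixes s :: "'a::{alg_closed_field, field_char_0} \<Rightarrow> 'v::ab_group_add \<Rightarrow> 'v"
  assumes irr: "lie_module_irreducible sl2_scale sl2_bracket s act"
    and dim: "vector_space.dim s (UNIV :: 'v set) = d + 1"
  shows "\<exists>v. sl2_module.highest_weight_vector s act d v"
proof -
  interpret sl2_module s act
    using irr unfolding lie_module_irreducible_def sl2_module_def by blast
  have dim0: "V.dim UNIV \<noteq> 0" using dim by simp
  obtain c u where u: "u \<noteq> 0" "act sl2_h u = s c u"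
    using exists_eigenvector[OF linear_act dim0] by blast
  have "\<exists>n. (act sl2_e ^^ n) u = 0"
    by (rule eigenvectors_vanish[OF linear_act dim0 _ h_e_power[OF u(2)]]) (simp add: inj_def)
  then obtain n where n: "(act sl2_e ^^ n) u \<noteq> 0" "(act sl2_e ^^ Suc n) u = 0"
    using u(1) exists_least_lemma[of "\<lambda>n. (act sl2_e ^^ n) u = 0"] by auto
  define v where "v = (act sl2_e ^^ n) u"
  define b where "b = c + 2 * of_nat n"
  have v: "v \<noteq> 0" "act sl2_e v = 0" "act sl2_h v = s b v"
    using n h_e_power[OF u(2)] by (simp_all add: v_def b_def)
  define w where "w i = (act sl2_f ^^ i) v" for i
  have h: "act sl2_h (w i) = s (b - 2 * of_nat i) (w i)" for i
    unfolding w_def by (rule h_f_power[OF v(3)])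
  have e: "act sl2_e (w (Suc i)) = s (of_nat (Suc i) * (b - of_nat i)) (w i)" for i
    unfolding w_def by (rule e_f_power[OF v(3,2)])
  have f: "act sl2_f (w i) = w (Suc i)" for i by (simp add: w_def)
  have "\<exists>n. w n = 0"
    by (rule eigenvectors_vanish[OF linear_act dim0 _ h]) (simp add: inj_def)
  then obtain m where m: "w m \<noteq> 0" "w (Suc m) = 0"
    using v(1) exists_least_lemma[of "\<lambda>n. w n = 0"] by (auto simp: w_def)
  \<comment> \<open>\<open>m\<close> is only known as a place where the chain passes from nonzero to
    zero. As f maps 0 to 0, no earlier vector vanishes.\<close>
  have nz: "w i \<noteq> 0" if "i \<le> m" for i
  proof
    assume "w i = 0"
    then have "w (i + k) = 0" for k by (induction k) (simp_all flip: f)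
    from this[of "m - i"] that m show False by simp
  qed
  \<comment> \<open>Applying e to f^(m+1) v = 0 forces the highest weight \<open>b\<close> to be the
    length \<open>m\<close> of the chain.\<close>
  have "s (of_nat (Suc m) * (b - of_nat m)) (w m) = 0"
    using e[of m] by (simp only: m act_zero)
  with m have b: "b = of_nat m" by (simp del: of_nat_Suc)
  have ind: "V.independent (w ` {..m})" "inj_on w {..m}"
    using eigenvectors_independent[OF linear_act, of "\<lambda>i. b - 2 * of_nat i" "Suc m" sl2_h w] h nz
    by (simp_all add: lessThan_Suc_atMost inj_on_def)
  let ?W = "V.span (w ` {..m})"
  have gen: "act sl2_h (w i) \<in> ?W" "act sl2_e (w i) \<in> ?W" "act sl2_f (w i) \<in> ?W" if "i \<le> m" for i
  proof -
    have base: "w j \<in> ?W" if "j \<le> m" for j using that by (intro V.span_base) auto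
    show "act sl2_h (w i) \<in> ?W" unfolding h using base[OF that] by (rule V.span_scale)
    show "act sl2_e (w i) \<in> ?W"
    proof (cases i)
      case 0
      then show ?thesis by (simp add: w_def v V.span_zero)
    next
      case (Suc j)
      then show ?thesis using base[of j] that by (simp only: e) (simp add: V.span_scale)
    qed
    show "act sl2_f (w i) \<in> ?W"
      using base[of "Suc i"] that m(2) by (cases "i = m") (simp_all add: f V.span_zero)
  qed
  have "act \<xi> x \<in> ?W" if "x \<in> ?W" for \<xi> x
  proof -
    obtain p q r where \<xi>: "\<xi> = sl2_mk p q r" by (rule sl2_mk_cases)
    interpret l: Vector_Spaces.linear s s "act \<xi>" by (rule linear_act)
    have "act \<xi> ` (w ` {..m}) \<subseteq> ?W"
      using gen by (auto simp: \<xi> act_sl2_mk intro!: V.span_add V.span_scale)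
    then have "V.span (act \<xi> ` (w ` {..m})) \<subseteq> ?W"
      by (rule V.span_minimal) (rule V.subspace_span)
    with that show ?thesis by (auto simp: l.span_image)
  qed
  then have "?W = {0} \<or> ?W = UNIV"
    using irr V.subspace_span unfolding lie_module_irreducible_def by blast
  moreover have "w 0 \<in> ?W" "w 0 \<noteq> 0"
    using nz[of 0] by (auto intro: V.span_base)
  ultimately have span: "?W = UNIV" by auto
  \<comment> \<open>The chain is now a basis with m + 1 elements, and comparison with the dimension
    gives m = d.\<close>
  have "card (w ` {..m}) = V.dim UNIV"
    using V.dim_eq_card[of "w ` {..m}" UNIV] ind span by simp
  then have "m = d" using ind(2) dim by (simp add: card_image)
  with ind span b v m have "highest_weight_vector d v"
    unfolding highest_weight_vector_def w_def by simp
  then show ?thesis by blast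
qed

section \<open>Uniqueness of the irreducible module of a given dimension\<close>

text \<open>On the basis of iterates f^i v the coefficients of h, e and f depend only on d and i, so
  matching the two bases commutes with the action.\<close>

lemma highest_weight_intertwiner:
  fixes s :: "'a::field_char_0 \<Rightarrow> 'v::ab_group_add \<Rightarrow> 'v"
    and s' :: "'a \<Rightarrow> 'w::ab_group_add \<Rightarrow> 'w"
  assumes "sl2_module s act" "sl2_module s' act'"
    and hv: "sl2_module.highest_weight_vector s act d v"
    and hv': "sl2_module.highest_weight_vector s' act' d v'"
  shows "\<exists>\<gamma>. Vector_Spaces.linear s s' \<gamma> \<and> (\<forall>\<xi> x. \<gamma> (act \<xi> x) = act' \<xi> (\<gamma> x)) \<and>
    (\<forall>i\<le>d. \<gamma> ((act sl2_f ^^ i) v) = (act' sl2_f ^^ i) v')"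
proof -
  interpret M: sl2_module s act by fact
  interpret M': sl2_module s' act' by fact
  interpret vector_space_pair s s' by unfold_locales
  define w where "w i = (act sl2_f ^^ i) v" for i
  define w' where "w' i = (act' sl2_f ^^ i) v'" for i
  have hw: "act sl2_h v = s (of_nat d) v" "act sl2_e v = 0" "w (Suc d) = 0" "inj_on w {..d}"
      "M.V.independent (w ` {..d})" "M.V.span (w ` {..d}) = UNIV"
    using hv unfolding M.highest_weight_vector_def w_def by simp_all
  have hw': "act' sl2_h v' = s' (of_nat d) v'" "act' sl2_e v' = 0" "w' (Suc d) = 0"
    using hv' unfolding M'.highest_weight_vector_def w'_def by simp_all
  obtain \<gamma> where \<gamma>: "Vector_Spaces.linear s s' \<gamma>" "\<forall>x\<in>w ` {..d}. \<gamma> x = w' (the_inv_into {..d} w x)"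
    using linear_independent_extend[OF hw(5), of "\<lambda>x. w' (the_inv_into {..d} w x)"] by blast
  interpret \<gamma>: Vector_Spaces.linear s s' \<gamma> by fact
  \<comment> \<open>The index d + 1, where both chains are 0, is included for the action of f on the
    last basis vector.\<close>
  have \<gamma>_w: "\<gamma> (w i) = w' i" if "i \<le> Suc d" for i
  proof (cases "i = Suc d")
    case True
    then show ?thesis by (simp add: hw hw' \<gamma>.zero)
  next
    case False
    with that show ?thesis using \<gamma>(2) by (simp add: the_inv_into_f_f[OF hw(4)])
  qed
  have h: "\<gamma> (act sl2_h (w i)) = act' sl2_h (\<gamma> (w i))" if "i \<le> d" for i
    using that M.h_f_power[OF hw(1), of i, folded w_def] M'.h_f_power[OF hw'(1), of i, folded w'_def]
    by (simp add: \<gamma>_w \<gamma>.scale)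
  have e: "\<gamma> (act sl2_e (w i)) = act' sl2_e (\<gamma> (w i))" if "i \<le> d" for i
  proof (cases i)
    case 0
    then show ?thesis by (simp add: \<gamma>_w) (simp add: w_def w'_def hw hw' \<gamma>.zero)
  next
    case (Suc j)
    then show ?thesis
      using that M.e_f_power[OF hw(1,2), of j, folded w_def] M'.e_f_power[OF hw'(1,2), of j, folded w'_def]
      by (simp add: \<gamma>_w \<gamma>.scale)
  qed
  have f: "\<gamma> (act sl2_f (w i)) = act' sl2_f (\<gamma> (w i))" if "i \<le> d" for i
    using that \<gamma>_w[of "Suc i"] \<gamma>_w[of i] by (simp add: w_def w'_def)
  have "\<gamma> (act \<xi> x) = act' \<xi> (\<gamma> x)" for \<xi> x
  proof -
    obtain p q r where \<xi>: "\<xi> = sl2_mk p q r" by (rule sl2_mk_cases)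
    have "(\<gamma> \<circ> act \<xi>) x = (act' \<xi> \<circ> \<gamma>) x"
    proof (rule linear_eq_on)
      show "Vector_Spaces.linear s s' (\<gamma> \<circ> act \<xi>)" "Vector_Spaces.linear s s' (act' \<xi> \<circ> \<gamma>)"
        using Vector_Spaces.linear_compose M.linear_act M'.linear_act \<gamma>(1) by blast+
      show "x \<in> M.V.span (w ` {..d})" by (simp add: hw)
    qed (auto simp: \<xi> M.act_sl2_mk M'.act_sl2_mk \<gamma>.add \<gamma>.scale h e f)
    then show ?thesis by simp
  qed
  with \<gamma>(1) \<gamma>_w show ?thesis unfolding w_def w'_def by fastforce
qed

text \<open>The intertwiners in the two directions exchange the bases of iterates, hence are inverse
  to each other.\<close>

theorem irreducible_sl2_modules_iso:
  fixes s :: "'a::{alg_closed_field, field_char_0} \<Rightarrow> 'v::ab_group_add \<Rightarrow> 'v"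
    and s' :: "'a \<Rightarrow> 'w::ab_group_add \<Rightarrow> 'w"
  assumes irr: "lie_module_irreducible sl2_scale sl2_bracket s act"
      "lie_module_irreducible sl2_scale sl2_bracket s' act'"
    and dim: "vector_space.dim s (UNIV :: 'v set) = d + 1" "vector_space.dim s' (UNIV :: 'w set) = d + 1"
  shows "lie_module_iso sl2_scale sl2_bracket s act s' act'"
proof -
  interpret M: sl2_module s act
    using irr(1) unfolding lie_module_irreducible_def sl2_module_def by blast
  interpret M': sl2_module s' act'
    using irr(2) unfolding lie_module_irreducible_def sl2_module_def by blast
  interpret P: vector_space_pair s s by unfold_locales
  interpret P': vector_space_pair s' s' by unfold_locales
  obtain v where v: "M.highest_weight_vector d v"
    using exists_highest_weight_vector[OF irr(1) dim(1)] by blast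
  obtain v' where v': "M'.highest_weight_vector d v'"
    using exists_highest_weight_vector[OF irr(2) dim(2)] by blast
  note M = M.sl2_module_axioms M'.sl2_module_axioms
  obtain \<gamma> where \<gamma>: "Vector_Spaces.linear s s' \<gamma>" "\<And>\<xi> x. \<gamma> (act \<xi> x) = act' \<xi> (\<gamma> x)"
      "\<And>i. i \<le> d \<Longrightarrow> \<gamma> ((act sl2_f ^^ i) v) = (act' sl2_f ^^ i) v'"
    using highest_weight_intertwiner[OF M v v'] by blast
  obtain \<delta> where \<delta>: "Vector_Spaces.linear s' s \<delta>"
      "\<And>i. i \<le> d \<Longrightarrow> \<delta> ((act' sl2_f ^^ i) v') = (act sl2_f ^^ i) v"
    using highest_weight_intertwiner[OF M(2,1) v' v] by blast
  have "(\<delta> \<circ> \<gamma>) x = id x" for x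
  proof (rule P.linear_eq_on[where f = "\<delta> \<circ> \<gamma>" and g = id and x = x and B = "(\<lambda>i. (act sl2_f ^^ i) v) ` {..d}"])
    show "Vector_Spaces.linear s s (\<delta> \<circ> \<gamma>)"
      using Vector_Spaces.linear_compose \<gamma>(1) \<delta>(1) by blast
    show "Vector_Spaces.linear s s id" by (rule M.V.linear_id)
    show "x \<in> M.V.span ((\<lambda>i. (act sl2_f ^^ i) v) ` {..d})"
      using v by (simp add: M.highest_weight_vector_def)
  qed (auto simp: \<gamma> \<delta>)
  moreover have "(\<gamma> \<circ> \<delta>) x = id x" for x
  proof (rule P'.linear_eq_on[where f = "\<gamma> \<circ> \<delta>" and g = id and x = x and B = "(\<lambda>i. (act' sl2_f ^^ i) v') ` {..d}"])
    show "Vector_Spaces.linear s' s' (\<gamma> \<circ> \<delta>)"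
      using Vector_Spaces.linear_compose \<gamma>(1) \<delta>(1) by blast
    show "Vector_Spaces.linear s' s' id" by (rule M'.V.linear_id)
    show "x \<in> M'.V.span ((\<lambda>i. (act' sl2_f ^^ i) v') ` {..d})"
      using v' by (simp add: M'.highest_weight_vector_def)
  qed (auto simp: \<gamma> \<delta>)
  ultimately have "bij \<gamma>" by (intro o_bij[of \<delta>]) auto
  with \<gamma>(1,2) M.lie_module_axioms M'.lie_module_axioms show ?thesis
    unfolding lie_module_iso_def by blast
qed

section \<open>Homomorphisms and modules\<close>

lemma lie_hom_comp:
  assumes "lie_hom s1 br1 s2 br2 \<phi>" "lie_hom s2 br2 s3 br3 \<psi>"
  shows "lie_hom s1 br1 s3 br3 (\<psi> \<circ> \<phi>)"
proof -
  interpret \<phi>: lie_hom s1 br1 s2 br2 \<phi> by fact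
  interpret \<psi>: lie_hom s2 br2 s3 br3 \<psi> by fact
  show ?thesis
    by unfold_locales
      (simp_all add: \<phi>.add \<psi>.add \<phi>.scale \<psi>.scale \<phi>.hom_bracket \<psi>.hom_bracket)
qed

lemma lie_hom_id:
  assumes "lie_algebra s br"
  shows "lie_hom s br s br id"
proof -
  interpret lie_algebra s br by fact
  interpret Vector_Spaces.linear s s id by (rule linear_id)
  show ?thesis by unfold_locales simp
qed

text \<open>The uniqueness part of \<open>tet_universal\<close> is applied to the values of
  \<open>\<phi>\<close> itself; these satisfy the relations because \<open>\<phi>\<close> is a
  homomorphism.\<close>

lemma tet_hom_eqI:
  fixes s :: "'a::field \<Rightarrow> 'l::ab_group_add \<Rightarrow> 'l"
  assumes "lie_hom tet_scale tet_bracket s br \<phi>" "lie_hom tet_scale tet_bracket s br \<psi>"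
    and "\<And>i j. i \<noteq> j \<Longrightarrow> \<phi> (tet_x i j) = \<psi> (tet_x i j)"
  shows "\<phi> = \<psi>"
proof -
  interpret \<phi>: lie_hom tet_scale tet_bracket s br \<phi> by fact
  have "\<exists>!f. lie_hom tet_scale tet_bracket s br f \<and> (\<forall>i j. i \<noteq> j \<longrightarrow> f (tet_x i j) = \<phi> (tet_x i j))"
  proof (rule tet_universal)
    show "lie_algebra s br" by (rule \<phi>.L2.lie_algebra_axioms)
    show "\<phi> (tet_x i j) + \<phi> (tet_x j i) = 0" if "i \<noteq> j" for i j
      using tet_relations(1)[OF that, where 'a = 'a] by (metis \<phi>.add \<phi>.zero)
    show "br (\<phi> (tet_x i j)) (\<phi> (tet_x j k)) = s 2 (\<phi> (tet_x i j)) + s 2 (\<phi> (tet_x j k))"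
      if "distinct [i, j, k]" for i j k
      using tet_relations(2)[OF that, where 'a = 'a] by (simp flip: \<phi>.hom_bracket \<phi>.add \<phi>.scale)
    show "br (\<phi> (tet_x i j)) (br (\<phi> (tet_x i j)) (br (\<phi> (tet_x i j)) (\<phi> (tet_x k l)))) =
        s 4 (br (\<phi> (tet_x i j)) (\<phi> (tet_x k l)))" if "distinct [i, j, k, l]" for i j k l
      using tet_relations(3)[OF that, where 'a = 'a] by (simp flip: \<phi>.hom_bracket \<phi>.scale)
  qed
  with assms show ?thesis by metis
qed

lemma S4_aut_comp:
  assumes "bij \<sigma>" "bij \<tau>"
  shows "S4_aut (\<sigma> \<circ> \<tau>) = (S4_aut \<sigma> \<circ> S4_aut \<tau> :: 'a::field tet \<Rightarrow> _)"
proof (rule tet_hom_eqI)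
  show "lie_hom tet_scale tet_bracket tet_scale tet_bracket (S4_aut \<sigma> \<circ> S4_aut \<tau> :: 'a tet \<Rightarrow> _)"
    using S4_aut(1) assms lie_hom_comp by blast
  show "lie_hom tet_scale tet_bracket tet_scale tet_bracket (S4_aut (\<sigma> \<circ> \<tau>) :: 'a tet \<Rightarrow> _)"
    by (intro S4_aut(1) bij_comp assms)
  show "S4_aut (\<sigma> \<circ> \<tau>) (tet_x i j) = (S4_aut \<sigma> \<circ> S4_aut \<tau>) (tet_x i j :: 'a tet)" if "i \<noteq> j" for i j
    using that assms bij_is_inj[OF assms(2)] by (simp add: S4_aut(2) bij_comp inj_eq)
qed

lemma S4_aut_id: "S4_aut id = (id :: 'a::field tet \<Rightarrow> _)"
proof (rule tet_hom_eqI)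
  show "lie_hom tet_scale tet_bracket tet_scale tet_bracket (id :: 'a tet \<Rightarrow> _)"
    by (rule lie_hom_id[OF lie_algebra_tet])
qed (simp_all add: S4_aut)

section \<open>Pulling modules back along homomorphisms\<close>

lemma lie_module_pullback:
  assumes "lie_hom s1 br1 s2 br2 \<phi>" "lie_module s2 br2 s act"
  shows "lie_module s1 br1 s (\<lambda>\<xi>. act (\<phi> \<xi>))"
proof -
  interpret \<phi>: lie_hom s1 br1 s2 br2 \<phi> by fact
  interpret M: lie_module s2 br2 s act by fact
  show ?thesis
    by unfold_locales
      (simp_all add: \<phi>.add \<phi>.scale \<phi>.hom_bracket M.act_add_left M.act_scale_left
        M.act_add_right M.act_scale_right M.act_bracket)
qed

text \<open>By surjectivity the same operators act before and after pulling back, so the invariant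
  subspaces are the same.\<close>

lemma lie_module_irreducible_pullback:
  assumes "lie_hom s1 br1 s2 br2 \<phi>" "surj \<phi>" "lie_module_irreducible s2 br2 s act"
  shows "lie_module_irreducible s1 br1 s (\<lambda>\<xi>. act (\<phi> \<xi>))"
  using assms(3) lie_module_pullback[OF assms(1)] \<open>surj \<phi>\<close>
  unfolding lie_module_irreducible_def by (metis surjD)

lemma lie_module_iso_pullback:
  assumes "lie_hom s1 br1 s2 br2 \<phi>" "lie_module_iso s2 br2 s act s' act'"
  shows "lie_module_iso s1 br1 s (\<lambda>\<xi>. act (\<phi> \<xi>)) s' (\<lambda>\<xi>. act' (\<phi> \<xi>))"
  using assms(2) unfolding lie_module_iso_def by (metis lie_module_pullback[OF assms(1)])

section \<open>Conjugation and the evaluation homomorphisms\<close>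

text \<open>Conjugation by the matrix with rows (\<alpha>, \<beta>) and (\<gamma>, \<delta>), its
  inverse written as the adjugate over the determinant. For determinant 0 the convention
  \<open>inverse 0 = 0\<close> makes it the zero map.\<close>

lift_definition sl2_conj :: "'a::field \<Rightarrow> 'a \<Rightarrow> 'a \<Rightarrow> 'a \<Rightarrow> 'a sl2 \<Rightarrow> 'a sl2" is
  "\<lambda>\<alpha> \<beta> \<gamma> \<delta> M. \<chi> i j. inverse (\<alpha> * \<delta> - \<beta> * \<gamma>) *
     (vector [vector [\<alpha>, \<beta>], vector [\<gamma>, \<delta>]] ** M ** vector [vector [\<delta>, - \<beta>], vector [- \<gamma>, \<alpha>]]) $ i $ j"
proof -
  fix \<alpha> \<beta> \<gamma> \<delta> :: 'a and M :: "'a^2^2" assume "trace M = 0"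
  then have M: "M $ 2 $ 2 = - (M $ 1 $ 1)" by (simp add: trace_def sum_2 add_eq_0_iff)
  show "trace (\<chi> i j. inverse (\<alpha> * \<delta> - \<beta> * \<gamma>) *
     (vector [vector [\<alpha>, \<beta>], vector [\<gamma>, \<delta>]] ** M **
      vector [vector [\<delta>, - \<beta>], vector [- \<gamma>, \<alpha>]]) $ i $ j :: 'a^2^2) = 0"
    unfolding trace_def sum_2 by (simp add: sum_2 matrix_matrix_mult_def M) (simp add: algebra_simps)
qed

lemma sl2_conj_mk:
  "sl2_conj \<alpha> \<beta> \<gamma> \<delta> (sl2_mk p q r) = sl2_scale (inverse (\<alpha> * \<delta> - \<beta> * \<gamma>))
     (sl2_mk ((\<alpha> * \<delta> + \<beta> * \<gamma>) * p - \<alpha> * \<gamma> * q + \<beta> * \<delta> * r)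
       (- 2 * \<alpha> * \<beta> * p + \<alpha> * \<alpha> * q - \<beta> * \<beta> * r) (2 * \<gamma> * \<delta> * p - \<gamma> * \<gamma> * q + \<delta> * \<delta> * r))"
  by transfer (simp add: vec_eq_iff forall_2 matrix_matrix_mult_def sum_2 algebra_simps)

lemma lie_hom_sl2_conj:
  fixes \<alpha> \<beta> \<gamma> \<delta> :: "'a::field"
  assumes "\<alpha> * \<delta> - \<beta> * \<gamma> \<noteq> 0"
  shows "lie_hom sl2_scale sl2_bracket sl2_scale sl2_bracket (sl2_conj \<alpha> \<beta> \<gamma> \<delta>)"
proof -
  interpret lie_algebra sl2_scale "sl2_bracket :: 'a sl2 \<Rightarrow> _" by (rule lie_algebra_sl2)
  \<comment> \<open>With \<open>J\<close> as an unknown subject to J det = 1, compatibility with the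
    bracket becomes a polynomial identity.\<close>
  define J where "J = inverse (\<alpha> * \<delta> - \<beta> * \<gamma>)"
  have J: "J * (\<alpha> * \<delta> - \<beta> * \<gamma>) = 1" using assms by (simp add: J_def)
  show ?thesis
  proof unfold_locales
    fix M N :: "'a sl2" and c
    obtain p q r where M: "M = sl2_mk p q r" by (rule sl2_mk_cases)
    obtain p' q' r' where N: "N = sl2_mk p' q' r'" by (rule sl2_mk_cases)
    show "sl2_conj \<alpha> \<beta> \<gamma> \<delta> (M + N) = sl2_conj \<alpha> \<beta> \<gamma> \<delta> M + sl2_conj \<alpha> \<beta> \<gamma> \<delta> N"
      unfolding M N sl2_mk_simps sl2_conj_mk by (rule sl2_mk_cong; algebra)
    show "sl2_conj \<alpha> \<beta> \<gamma> \<delta> (sl2_scale c M) = sl2_scale c (sl2_conj \<alpha> \<beta> \<gamma> \<delta> M)"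
      unfolding M sl2_mk_simps sl2_conj_mk by (rule sl2_mk_cong; algebra)
    show "sl2_conj \<alpha> \<beta> \<gamma> \<delta> (sl2_bracket M N) =
        sl2_bracket (sl2_conj \<alpha> \<beta> \<gamma> \<delta> M) (sl2_conj \<alpha> \<beta> \<gamma> \<delta> N)"
      unfolding M N sl2_mk_simps sl2_conj_mk J_def[symmetric]
      by (rule sl2_mk_cong; use J in algebra)
  qed
qed

text \<open>A right inverse is conjugation by the adjugate: it has the same determinant and is the
  inverse matrix up to a scalar, which conjugation ignores.\<close>

lemma surj_sl2_conj:
  fixes \<alpha> \<beta> \<gamma> \<delta> :: "'a::field"
  assumes "\<alpha> * \<delta> - \<beta> * \<gamma> \<noteq> 0"
  shows "surj (sl2_conj \<alpha> \<beta> \<gamma> \<delta>)"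
proof (rule surjI)
  fix M :: "'a sl2"
  obtain p q r where M: "M = sl2_mk p q r" by (rule sl2_mk_cases)
  define J where "J = inverse (\<alpha> * \<delta> - \<beta> * \<gamma>)"
  have J: "J * (\<alpha> * \<delta> - \<beta> * \<gamma>) = 1" using assms by (simp add: J_def)
  have J': "inverse (\<delta> * \<alpha> - (- \<beta>) * (- \<gamma>)) = J" by (simp add: J_def mult.commute)
  show "sl2_conj \<alpha> \<beta> \<gamma> \<delta> (sl2_conj \<delta> (- \<beta>) (- \<gamma>) \<alpha> M) = M"
    unfolding M sl2_mk_simps sl2_conj_mk J' J_def[symmetric]
    by (rule sl2_mk_cong; use J in algebra)
qed

text \<open>The matrix with eigenvalues -1 at \<open>(u, v)\<close> and 1 at \<open>(u', v')\<close>.\<close>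

definition sl2_eigen :: "'a::field \<Rightarrow> 'a \<Rightarrow> 'a \<Rightarrow> 'a \<Rightarrow> 'a sl2" where
  "sl2_eigen u v u' v' =
     sl2_scale (inverse (u' * v - u * v')) (sl2_mk (u * v' + v * u') (- 2 * u * u') (2 * v * v'))"

lemma EV_gen_eq_eigen: "EV_gen a i j = sl2_eigen (EV_u i) (EV_v a i) (EV_u j) (EV_v a j)"
  by (simp add: EV_gen_def sl2_eigen_def Let_def)

text \<open>Conjugation by g carries eigenvectors w to g w and keeps the eigenvalues. The
  determinants multiply, and in the singular cases both sides are 0 since
  \<open>inverse 0 = 0\<close>.\<close>

lemma sl2_conj_eigen:
  "sl2_conj \<alpha> \<beta> \<gamma> \<delta> (sl2_eigen u v u' v') =
     sl2_eigen (\<alpha> * u + \<beta> * v) (\<gamma> * u + \<delta> * v) (\<alpha> * u' + \<beta> * v') (\<gamma> * u' + \<delta> * v')"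
proof -
  have "(\<alpha> * u' + \<beta> * v') * (\<gamma> * u + \<delta> * v) - (\<alpha> * u + \<beta> * v) * (\<gamma> * u' + \<delta> * v') =
      (\<alpha> * \<delta> - \<beta> * \<gamma>) * (u' * v - u * v')"
    by algebra
  then have det: "inverse ((\<alpha> * u' + \<beta> * v') * (\<gamma> * u + \<delta> * v) - (\<alpha> * u + \<beta> * v) * (\<gamma> * u' + \<delta> * v')) =
      inverse (\<alpha> * \<delta> - \<beta> * \<gamma>) * inverse (u' * v - u * v')"
    by simp
  define J where "J = inverse (\<alpha> * \<delta> - \<beta> * \<gamma>)"
  define K where "K = inverse (u' * v - u * v')"
  show ?thesis
    unfolding sl2_eigen_def sl2_mk_simps sl2_conj_mk det J_def[symmetric] K_def[symmetric]
    by (rule sl2_mk_cong; algebra)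
qed

text \<open>Numerator and determinant both scale by c c', so only the points of the projective line
  matter.\<close>

lemma sl2_eigen_scale:
  assumes "c \<noteq> 0" "c' \<noteq> 0"
  shows "sl2_eigen (c * u) (c * v) (c' * u') (c' * v') = sl2_eigen u v u' v'"
proof -
  have "(c' * u') * (c * v) - (c * u) * (c' * v') = c * c' * (u' * v - u * v')" by algebra
  moreover have "c * inverse c = 1" "c' * inverse c' = 1" using assms by simp_all
  ultimately show ?thesis
    unfolding sl2_eigen_def sl2_mk_simps
    by (simp only: inverse_mult_distrib) (rule sl2_mk_cong; algebra)
qed

text \<open>The definition of \<open>EV\<close> prescribes six generators. The opposite six follow
  from x_ij = - x_ji, since \<open>EV a\<close> and the homomorphism \<open>\<psi>\<close> with
  values \<open>EV_gen a\<close> both respect signs.\<close>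

lemma EV_tet_x:
  assumes a: "a \<notin> {0, 1}" and "i \<noteq> j"
  shows "EV a (tet_x i j) = EV_gen a i j"
proof -
  have a: "a \<noteq> 0" "a \<noteq> 1" using a by auto
  obtain \<psi> where \<psi>: "lie_hom tet_scale tet_bracket sl2_scale sl2_bracket \<psi>"
      "\<And>i j. i \<noteq> j \<Longrightarrow> \<psi> (tet_x i j) = EV_gen a i j"
    using EV_ex1[OF a] by blast
  interpret \<phi>: lie_hom tet_scale tet_bracket sl2_scale sl2_bracket "EV a" by (rule EV(1)[OF a])
  interpret \<psi>: lie_hom tet_scale tet_bracket sl2_scale sl2_bracket \<psi> by (rule \<psi>(1))
  have "tet_x i j = - (tet_x j i :: 'a tet)" if "i \<noteq> j" for i j
    using tet_relations(1)[OF that] by (rule eq_neg_iff_add_eq_0[THEN iffD2])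
  then have sw: "EV a (tet_x i j) = EV_gen a i j" if "EV a (tet_x j i) = EV_gen a j i" "i \<noteq> j" for i j
    using that \<psi>(2) \<phi>.neg \<psi>.neg by metis
  have v: "EV a (tet_x 1 2) = EV_gen a 1 2" "EV a (tet_x 2 3) = EV_gen a 2 3"
    "EV a (tet_x 3 1) = EV_gen a 3 1" "EV a (tet_x 0 3) = EV_gen a 0 3"
    "EV a (tet_x 0 1) = EV_gen a 0 1" "EV a (tet_x 0 2) = EV_gen a 0 2"
    by (simp_all add: EV_gen_values[OF a] EV[OF a])
  show ?thesis
    using \<open>i \<noteq> j\<close> index_cases[of i] index_cases[of j] v v[THEN sw] by auto
qed

section \<open>Evaluation homomorphisms under the action of S_4\<close>

text \<open>Of the conjugation \<open>\<theta>\<close> only surjectivity and the homomorphism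
  property are kept: they are stable under composition and suffice to pull back irreducible
  modules.\<close>

definition EV_twist_equiv :: "(4 \<Rightarrow> 4) \<Rightarrow> 'a::field \<Rightarrow> 'a \<Rightarrow> bool" where
  "EV_twist_equiv \<sigma> a b \<longleftrightarrow> (\<exists>\<theta>. lie_hom sl2_scale sl2_bracket sl2_scale sl2_bracket \<theta> \<and>
     surj \<theta> \<and> EV a \<circ> S4_aut (inv \<sigma>) = \<theta> \<circ> EV b)"

text \<open>The matrix sends the i-th point for \<open>b\<close> to the point with index
  \<open>inv \<sigma> i\<close> for \<open>a\<close>; \<open>c i\<close> is the scalar between the
  chosen representatives. So both composites have the same eigenlines on each generator.\<close>

lemma EV_twist_equivI:
  fixes a b :: "'a::field"
  assumes ab: "a \<notin> {0, 1}" "b \<notin> {0, 1}" and \<sigma>: "bij \<sigma>" and det: "\<alpha> * \<delta> - \<beta> * \<gamma> \<noteq> 0"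
    and g: "\<And>i. c i \<noteq> 0"
      "\<And>i. \<alpha> * EV_u i + \<beta> * EV_v b i = c i * EV_u (inv \<sigma> i)"
      "\<And>i. \<gamma> * EV_u i + \<delta> * EV_v b i = c i * EV_v a (inv \<sigma> i)"
  shows "EV_twist_equiv \<sigma> a b"
proof -
  have "EV a \<circ> S4_aut (inv \<sigma>) = sl2_conj \<alpha> \<beta> \<gamma> \<delta> \<circ> EV b"
  proof (rule tet_hom_eqI)
    show "lie_hom tet_scale tet_bracket sl2_scale sl2_bracket (EV a \<circ> S4_aut (inv \<sigma>))"
      using ab by (intro lie_hom_comp[OF S4_aut(1) EV(1)] bij_imp_bij_inv \<sigma>) auto
    show "lie_hom tet_scale tet_bracket sl2_scale sl2_bracket (sl2_conj \<alpha> \<beta> \<gamma> \<delta> \<circ> EV b)"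
      using ab by (intro lie_hom_comp[OF EV(1) lie_hom_sl2_conj] det) auto
    fix i j :: 4 assume "i \<noteq> j"
    moreover have "inv \<sigma> i \<noteq> inv \<sigma> j"
      using \<open>i \<noteq> j\<close> bij_is_inj[OF bij_imp_bij_inv[OF \<sigma>]] by (simp add: inj_eq)
    ultimately show "(EV a \<circ> S4_aut (inv \<sigma>)) (tet_x i j) = (sl2_conj \<alpha> \<beta> \<gamma> \<delta> \<circ> EV b) (tet_x i j)"
      using ab \<sigma>
      by (simp add: S4_aut bij_imp_bij_inv EV_tet_x EV_gen_eq_eigen sl2_conj_eigen g sl2_eigen_scale)
  qed
  with lie_hom_sl2_conj[OF det] surj_sl2_conj[OF det] show ?thesis
    unfolding EV_twist_equiv_def by blast
qed

text \<open>The given transpositions are the edges of the path 2 - 0 - 1 - 3. The others arise from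
  (i k) = (i j)(j k)(i j), and transpositions generate the group.\<close>

lemma S4_induct [consumes 1, case_names id comp t20 t01 t13]:
  fixes \<sigma> :: "4 \<Rightarrow> 4"
  assumes "bij \<sigma>" and id: "P id"
    and comp: "\<And>\<sigma> \<tau>. bij \<sigma> \<Longrightarrow> bij \<tau> \<Longrightarrow> P \<sigma> \<Longrightarrow> P \<tau> \<Longrightarrow> P (\<sigma> \<circ> \<tau>)"
    and g: "P (Transposition.transpose 2 0)" "P (Transposition.transpose 0 1)"
      "P (Transposition.transpose 1 3)"
  shows "P \<sigma>"
proof -
  let ?t = "Transposition.transpose :: 4 \<Rightarrow> 4 \<Rightarrow> 4 \<Rightarrow> 4"
  have conj: "P (?t i k)" if "P (?t i j)" "P (?t j k)" "distinct [i, j, k]" for i j k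
  proof -
    have "?t i k = ?t i j \<circ> ?t j k \<circ> ?t i j"
      using that(3) by (auto simp: fun_eq_iff Transposition.transpose_def)
    with that show ?thesis by (simp add: comp bij_comp)
  qed
  have "P (?t 2 1)" by (rule conj[OF g(1,2)]) simp
  moreover have "P (?t 0 3)" by (rule conj[OF g(2,3)]) simp
  moreover have "P (?t 2 3)" by (rule conj[OF \<open>P (?t 2 1)\<close> g(3)]) simp
  ultimately have t: "P (?t i j)" if "i \<noteq> j" for i j
    using that index_cases[of i] index_cases[of j] g by (auto simp: Transposition.transpose_commute)
  have "\<sigma> permutes UNIV" using \<open>bij \<sigma>\<close> by (simp add: permutes_univ bij_iff)
  from this finite[of UNIV] show "P \<sigma>"
  proof (induction rule: permutes_induct)
    case (swap i j \<tau>)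
    then show ?case by (intro comp t) (simp_all add: permutes_bij)
  qed (rule id)
qed

text \<open>In the coordinate \<open>v / u\<close> the matrices used for the three transpositions are the maps
  \<open>t \<mapsto> a t\<close>, \<open>t \<mapsto> (1 - a) t + a\<close> and \<open>t \<mapsto> 1 / t\<close>. They send the points
  \<open>(b, 0, 1, \<infinity>)\<close>, where \<open>b\<close> is the image of \<open>a\<close>, to the permuted points \<open>(a, 0, 1, \<infinity>)\<close>.\<close>

lemma EV_twist_equiv_S4_act:
  fixes a :: "'a::field"
  assumes "bij \<sigma>" "a \<notin> {0, 1}"
  shows "EV_twist_equiv \<sigma> a (S4_act \<sigma> a)"
  using assms
proof (induction arbitrary: a rule: S4_induct)
  note D = is_S4_actionD[OF is_S4_action_S4_act]
  note EV_uv = EV_u_def EV_v_def Transposition.transpose_def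
  {
    case id
    have "lie_hom sl2_scale sl2_bracket sl2_scale sl2_bracket (id :: 'a sl2 \<Rightarrow> _)"
      by (rule lie_hom_id[OF lie_algebra_sl2])
    then show ?case
      unfolding EV_twist_equiv_def D(2)[OF id] by (intro exI[of _ id]) (simp add: S4_aut_id)
  next
    case (comp \<sigma> \<tau>)
    \<comment> \<open>The hypothesis for \<sigma> is used at the parameter \<tau>(a), hence the
      induction over arbitrary \<open>a\<close>. Inversion reverses the product, so
      \<open>EV a\<close> meets the inverse of \<tau> first.\<close>
    have "S4_act \<tau> a \<notin> {0, 1}" by (rule D(1)[OF comp.hyps(2) comp.prems])
    then obtain \<theta> \<eta> where
      \<theta>: "lie_hom sl2_scale sl2_bracket sl2_scale sl2_bracket \<theta>" "surj \<theta>"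
        "EV a \<circ> S4_aut (inv \<tau>) = \<theta> \<circ> EV (S4_act \<tau> a)" and
      \<eta>: "lie_hom sl2_scale sl2_bracket sl2_scale sl2_bracket \<eta>" "surj \<eta>"
        "EV (S4_act \<tau> a) \<circ> S4_aut (inv \<sigma>) = \<eta> \<circ> EV (S4_act \<sigma> (S4_act \<tau> a))"
      using comp.IH comp.prems unfolding EV_twist_equiv_def by metis
    have "S4_aut (inv (\<sigma> \<circ> \<tau>)) = (S4_aut (inv \<tau>) \<circ> S4_aut (inv \<sigma>) :: 'a tet \<Rightarrow> _)"
      by (simp add: o_inv_distrib S4_aut_comp bij_imp_bij_inv comp.hyps)
    then have "EV a \<circ> S4_aut (inv (\<sigma> \<circ> \<tau>)) = (\<theta> \<circ> \<eta>) \<circ> EV (S4_act (\<sigma> \<circ> \<tau>) a)"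
      using \<theta>(3) \<eta>(3) D(3)[OF comp.hyps comp.prems] by (metis comp_assoc)
    with lie_hom_comp[OF \<eta>(1) \<theta>(1)] comp_surj[OF \<eta>(2) \<theta>(2)] show ?case
      unfolding EV_twist_equiv_def by blast
  next
    case t20
    then have "inverse a \<notin> {0, 1}" by auto
    with t20 show ?case
      unfolding D(4)[OF t20]
      \<comment> \<open>The representative (0, 1) of infinity goes to (0, a), which gives
        \<open>c 3 = a\<close>.\<close>
      by (intro EV_twist_equivI[where \<alpha> = 1 and \<beta> = 0 and \<gamma> = 0 and \<delta> = a and
            c = "\<lambda>i. if i = 3 then a else 1"])
        (simp_all, auto simp: EV_uv, use index_cases in blast)
  next
    case t01
    then have "a * inverse (a - 1) \<notin> {0, 1}" by (auto simp: field_simps)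
    with t01 show ?case
      unfolding D(5)[OF t01]
      by (intro EV_twist_equivI[where \<alpha> = 1 and \<beta> = 0 and \<gamma> = a and \<delta> = "1 - a" and
            c = "\<lambda>i. if i = 3 then 1 - a else 1"]) (simp_all, auto simp: EV_uv field_simps)
  next
    case t13
    then have "inverse a \<notin> {0, 1}" by auto
    with t13 show ?case
      unfolding D(6)[OF t13]
      \<comment> \<open>The swap of coordinates takes (1, 1/a) to (1/a, 1), which is 1/a times the
        representative (1, a).\<close>
      by (intro EV_twist_equivI[where \<alpha> = 0 and \<beta> = 1 and \<gamma> = 1 and \<delta> = 0 and
            c = "\<lambda>i. if i = 0 then inverse a else 1"]) (simp_all, auto simp: EV_uv)
  }
qed

theorem theorem7p7:
  fixes a :: "'a::{alg_closed_field, field_char_0}"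
    and d :: nat
    and \<sigma> :: "4 \<Rightarrow> 4"
    and s :: "'a \<Rightarrow> 'v::ab_group_add \<Rightarrow> 'v"
    and act :: "'a sl2 \<Rightarrow> 'v \<Rightarrow> 'v"
  assumes "d \<ge> 1"
    and "bij \<sigma>"
    and "a \<notin> {0, 1}"
    and V_irreducible: "lie_module_irreducible sl2_scale sl2_bracket s act"
    and V_dim: "vector_space.dim s (UNIV :: 'v set) = d + 1"
  shows "lie_module_iso tet_scale tet_bracket
           s (twist \<sigma> (EV_pullback a act))
           s (EV_pullback (S4_act \<sigma> a) act)"
proof -
  obtain \<theta> where \<theta>: "lie_hom sl2_scale sl2_bracket sl2_scale sl2_bracket \<theta>" "surj \<theta>"
      "EV a \<circ> S4_aut (inv \<sigma>) = \<theta> \<circ> EV (S4_act \<sigma> a)"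
    using EV_twist_equiv_S4_act[OF assms(2,3)] unfolding EV_twist_equiv_def by blast
  have "S4_act \<sigma> a \<notin> {0, 1}"
    by (rule is_S4_actionD(1)[OF is_S4_action_S4_act assms(2,3)])
  then have "lie_hom tet_scale tet_bracket sl2_scale sl2_bracket (EV (S4_act \<sigma> a))"
    by (intro EV(1)) auto
  \<comment> \<open>Pulled back along \<open>\<theta>\<close>, the module stays irreducible on the
    same space, so it is isomorphic to the original one by uniqueness.\<close>
  moreover have "lie_module_iso sl2_scale sl2_bracket s (\<lambda>\<xi>. act (\<theta> \<xi>)) s act"
    using lie_module_irreducible_pullback[OF \<theta>(1,2) V_irreducible] V_irreducible V_dim V_dim
    by (rule irreducible_sl2_modules_iso)
  ultimately have "lie_module_iso tet_scale tet_bracket s (\<lambda>\<xi>. act (\<theta> (EV (S4_act \<sigma> a) \<xi>)))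
      s (\<lambda>\<xi>. act (EV (S4_act \<sigma> a) \<xi>))"
    by (rule lie_module_iso_pullback)
  moreover have "twist \<sigma> (EV_pullback a act) = (\<lambda>\<xi>. act (\<theta> (EV (S4_act \<sigma> a) \<xi>)))"
    using \<theta>(3) by (simp add: twist_def EV_pullback_def fun_eq_iff)
  moreover have "EV_pullback (S4_act \<sigma> a) act = (\<lambda>\<xi>. act (EV (S4_act \<sigma> a) \<xi>))"
    by (simp add: EV_pullback_def fun_eq_iff)
  ultimately show ?thesis by simp
qed

end
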